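(* Let $\alpha>0$, $\kappa$, $\Omega$, $f$, and the multiscale space $V_{\mathrm{ms}}\subset H_0^1(\Omega)$ associated with a coarse grid of mesh size $H$ be as in the context. Let $C_{\mathrm{inv}}>0$ be a constant such that $\|\nabla v\|\le C_{\mathrm{inv}}H^{-1}\|v\|$ for all $v\in V_{\mathrm{ms}}$. Let $T>0$, $N_T\in\mathbb{N}^+$, $\Delta t=T/N_T$, $t_n=n\Delta t$, $f^n=f(t_n)\in L^2(\Omega)$, and let $(u_H^n)_{n=0}^{N_T}\subset V_{\mathrm{ms}}$ satisfy, for $n=1,\dots,N_T-1$, $$\Big(\tfrac{u_H^{n+1}-u_H^{n-1}}{2\Delta t}+\alpha\tfrac{u_H^{n+1}-2u_H^n+u_H^{n-1}}{(\Delta t)^2},v\Big)+a(u_H^n,v)=(f^n,v)\quad\text{for all }v\in V_{\mathrm{ms}}.$$ Assume that the CFL condition $$\alpha-\tfrac12\beta C_{\mathrm{inv}}^2H^{-2}(\Delta t)^2\ge\delta$$ holds for some constant $\delta>0$. Then the scheme is stable: there is a constant $C>0$, which may depend on $\alpha$ and $\delta$ but not on $n$, $\Delta t$, $H$, $f$ or the discrete solution, such that for every $n=1,\dots,N_T$ $$\alpha\Big\|\frac{u_H^n-u_H^{n-1}}{\Delta t}\Big\|+\|u_H^n\|_a\le C\Big(\Delta t\sum_{k=1}^n\|f^k\|+\alpha\Big\|\frac{u_H^1-u_H^0}{\Delta t}\Big\|+\|u_H^1\|_a+\|u_H^0\|_a\Big).$$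
   Context: Problem: $\Omega\subset\mathbb{R}^d$ ($d=2,3$) is a polygonal domain; $\kappa:\Omega\to\mathbb{R}$ is measurable with $0<\gamma\le\kappa(x)\le\beta$ a.e.; $V=H_0^1(\Omega)$; $(\cdot,\cdot)$ and $\|\cdot\|$ are the $L^2(\Omega)$ inner product and norm; $a(u,v)=\int_\Omega\kappa\nabla u\cdot\nabla v\,dx$; $\|v\|_a=\sqrt{a(v,v)}$. Coarse grid: $\mathcal{T}^H=\{K_i\}_{i=1}^N$ is a conforming partition of $\Omega$ into closed elements, $H=\max_{K\in\mathcal{T}^H}\max_{x,y\in K}|x-y|$. $\{\chi_j^{\mathrm{ms}}\}$ are the standard multiscale finite element functions, indexed by coarse nodes $x_j$ and forming a partition of unity: with $\omega_j$ the union of coarse elements having $x_j$ as a vertex, $\nabla\cdot(\kappa\nabla\chi_j^{\mathrm{ms}})=0$ in each $K\subset\omega_j$, $\chi_j^{\mathrm{ms}}=g_j$ on $\partial K\setminus\partial\omega_j$, where $g_j$ is continuous and linear along the boundaries of coarse elements, and $\chi_j^{\mathrm{ms}}=0$ on $\partial\omega_j$ (with the usual modification at boundary nodes). Auxiliary space: $\tilde\kappa=\sum_j\kappa|\nabla\chi_j^{\mathrm{ms}}|^2$, $V(K_i)$ is the restriction of $V$ to $K_i$, $a_i(v,w)=\int_{K_i}\kappa\nabla v\cdot\nabla w\,dx$, $s_i(v,w)=\int_{K_i}\tilde\kappa vw\,dx$, $s(v,w)=\sum_{i=1}^N s_i(v,w)$. The pairs $(\lambda_j^{(i)},\phi_j^{(i)})$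 with $\phi_j^{(i)}\in V(K_i)$ solve $a_i(\phi_j^{(i)},v)=\lambda_j^{(i)}s_i(\phi_j^{(i)},v)$ for all $v\in V(K_i)$, with eigenvalues in ascending order and eigenfunctions $s_i$-orthonormal (extended by zero outside $K_i$). For chosen $\ell_i\in\mathbb{N}^+$, $V_{\mathrm{aux}}=\bigoplus_{i=1}^N\mathrm{span}\{\phi_j^{(i)}:1\le j\le\ell_i\}$, and $\pi u=\sum_{i=1}^N\sum_{j=1}^{\ell_i}s_i(u,\phi_j^{(i)})\phi_j^{(i)}$ for $u\in L^2(\Omega)$. Multiscale space: for a fixed integer $m\ge0$, $K_{i,0}=K_i$ and $K_{i,m}=\bigcup\{K\in\mathcal{T}^H:K\cap K_{i,m-1}\ne\emptyset\}$ for $m\ge1$; $K_i^+=K_{i,m}$; $V_0(K_i^+)$ is the space of functions in $V$ restricted to $K_i^+$ with zero trace on $\partial K_i^+$ (extended by zero). The basis function $\psi_{j,\mathrm{ms}}^{(i)}\in V_0(K_i^+)$ is defined by $a(\psi_{j,\mathrm{ms}}^{(i)},v)+s(\pi\psi_{j,\mathrm{ms}}^{(i)},\pi v)=s(\phi_j^{(i)},v)$ for all $v\in V_0(K_i^+)$, and $V_{\mathrm{ms}}=\mathrm{span}\{\psi_{j,\mathrm{ms}}^{(i)}:1\le i\le N,\ 1\le j\le\ell_i\}$. *)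

theory Defs
  imports "HOL-Analysis.Analysis"
begin

section \<open>Lebesgue and Sobolev spaces\<close>

text \<open>Elements of $L^2$ and of the Sobolev spaces are represented by functions on the whole
  Euclidean space of which only the values in $U$ matter, up to null sets.\<close>

definition L2 :: "'a::euclidean_space set \<Rightarrow> ('a \<Rightarrow> 'b::euclidean_space) set" where
  "L2 U = {u \<in> borel_measurable (lebesgue_on U). integrable (lebesgue_on U) (\<lambda>x. (norm (u x))\<^sup>2)}"

definition L2_inner ::
  "'a::euclidean_space set \<Rightarrow> ('a \<Rightarrow> 'b::euclidean_space) \<Rightarrow> ('a \<Rightarrow> 'b) \<Rightarrow> real" where
  "L2_inner U u v = (\<integral>x. u x \<bullet> v x \<partial>lebesgue_on U)"

definition L2_norm :: "'a::euclidean_space set \<Rightarrow> ('a \<Rightarrow> 'b::euclidean_space) \<Rightarrow> real" where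
  "L2_norm U u = sqrt (L2_inner U u u)"

abbreviation partial_deriv :: "'a::euclidean_space \<Rightarrow> ('a \<Rightarrow> real) \<Rightarrow> 'a \<Rightarrow> real" where
  "partial_deriv b f \<equiv> (\<lambda>x. frechet_derivative f (at x) b)"

primrec Ck :: "nat \<Rightarrow> ('a::euclidean_space \<Rightarrow> real) \<Rightarrow> bool" where
  "Ck 0 f \<longleftrightarrow> continuous_on UNIV f"
| "Ck (Suc k) f \<longleftrightarrow> (\<forall>x. f differentiable at x) \<and> (\<forall>b\<in>Basis. Ck k (partial_deriv b f))"

definition test_functions :: "'a::euclidean_space set \<Rightarrow> ('a \<Rightarrow> real) set" where
  "test_functions U =
     {\<phi>. (\<forall>k. Ck k \<phi>) \<and> compact (closure {x. \<phi> x \<noteq> 0}) \<and> closure {x. \<phi> x \<noteq> 0} \<subseteq> U}"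

definition has_weak_gradient ::
  "'a::euclidean_space set \<Rightarrow> ('a \<Rightarrow> real) \<Rightarrow> ('a \<Rightarrow> 'a) \<Rightarrow> bool" where
  "has_weak_gradient U u g \<longleftrightarrow> g \<in> L2 U \<and>
     (\<forall>\<phi>\<in>test_functions U. \<forall>b\<in>Basis.
        (\<integral>x. u x * partial_deriv b \<phi> x \<partial>lebesgue_on U) = - (\<integral>x. (g x \<bullet> b) * \<phi> x \<partial>lebesgue_on U))"

definition H1 :: "'a::euclidean_space set \<Rightarrow> ('a \<Rightarrow> real) set" where
  "H1 U = {u \<in> L2 U. \<exists>g. has_weak_gradient U u g}"

text \<open>A representative; for open $U$ and $u \in H^1(U)$ it is unique up to null sets.\<close>

definition grad :: "'a::euclidean_space set \<Rightarrow> ('a \<Rightarrow> real) \<Rightarrow> 'a \<Rightarrow> 'a" where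
  "grad U u = (SOME g. has_weak_gradient U u g)"

definition H1_norm :: "'a::euclidean_space set \<Rightarrow> ('a \<Rightarrow> real) \<Rightarrow> real" where
  "H1_norm U u = sqrt ((L2_norm U u)\<^sup>2 + (L2_norm U (grad U u))\<^sup>2)"

definition H10 :: "'a::euclidean_space set \<Rightarrow> ('a \<Rightarrow> real) set" where
  "H10 U = {u \<in> H1 U. \<exists>\<phi>. (\<forall>k::nat. \<phi> k \<in> test_functions U) \<and>
     (\<lambda>k. H1_norm U (\<lambda>x. u x - \<phi> k x)) \<longlonglongrightarrow> 0}"

section \<open>Domain, coefficient, coarse grid\<close>

text \<open>The interior of a finite union of polytopes is open and bounded.\<close>

definition polygonal_domain :: "'a::euclidean_space set \<Rightarrow> bool" where
  "polygonal_domain \<Omega> \<longleftrightarrow> \<Omega> \<noteq> {} \<and> connected \<Omega> \<and>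
     (\<exists>P. finite P \<and> (\<forall>p\<in>P. polytope p) \<and> \<Omega> = interior (\<Union>P))"

definition coefficient :: "'a::euclidean_space set \<Rightarrow> ('a \<Rightarrow> real) \<Rightarrow> real \<Rightarrow> real \<Rightarrow> bool" where
  "coefficient \<Omega> \<kappa> \<gamma> \<beta> \<longleftrightarrow> \<kappa> \<in> borel_measurable (lebesgue_on \<Omega>) \<and> 0 < \<gamma> \<and>
     (AE x in lebesgue_on \<Omega>. \<gamma> \<le> \<kappa> x \<and> \<kappa> x \<le> \<beta>)"

definition a_form ::
  "('a::euclidean_space \<Rightarrow> real) \<Rightarrow> 'a set \<Rightarrow> ('a \<Rightarrow> real) \<Rightarrow> ('a \<Rightarrow> real) \<Rightarrow> real" where
  "a_form \<kappa> U u v = (\<integral>x. \<kappa> x * (grad U u x \<bullet> grad U v x) \<partial>lebesgue_on U)"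

definition a_norm :: "('a::euclidean_space \<Rightarrow> real) \<Rightarrow> 'a set \<Rightarrow> ('a \<Rightarrow> real) \<Rightarrow> real" where
  "a_norm \<kappa> U v = sqrt (a_form \<kappa> U v v)"

text \<open>Coarse elements are convex polytopes; conforming means that two of them meet in a
  (possibly empty) common face.\<close>

definition coarse_grid :: "'a::euclidean_space set \<Rightarrow> 'a set set \<Rightarrow> bool" where
  "coarse_grid \<Omega> \<T> \<longleftrightarrow> finite \<T> \<and> (\<forall>K\<in>\<T>. polytope K \<and> interior K \<noteq> {}) \<and> \<Union>\<T> = closure \<Omega> \<and>
     (\<forall>K\<in>\<T>. \<forall>L\<in>\<T>. K \<noteq> L \<longrightarrow>
        interior K \<inter> interior L = {} \<and> K \<inter> L face_of K \<and> K \<inter> L face_of L)"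

definition mesh_size :: "'a::euclidean_space set set \<Rightarrow> real" where
  "mesh_size \<T> = Max (diameter ` \<T>)"

definition nodes :: "'a::euclidean_space set set \<Rightarrow> 'a set" where
  "nodes \<T> = {x. \<exists>K\<in>\<T>. x extreme_point_of K}"

definition node_patch :: "'a::euclidean_space set set \<Rightarrow> 'a \<Rightarrow> 'a set" where
  "node_patch \<T> x = \<Union>{K\<in>\<T>. x extreme_point_of K}"

section \<open>Multiscale finite element functions\<close>

text \<open>The functions $\chi^{\mathrm{ms}}$ are called $\eta$, since the letter chi is the binder of
  finite vectors.\<close>

text \<open>Linearity along an element boundary is required on every segment that lies in a facet and
  is parallel to an edge of that facet. In the plane this is linearity on the edges. In space it is
  linearity on triangular facets and the usual bilinearity on parallelogram facets, where a linear
  function with prescribed nodal values need not exist.\<close>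

definition linear_along_boundary :: "'a::euclidean_space set \<Rightarrow> ('a \<Rightarrow> real) \<Rightarrow> bool" where
  "linear_along_boundary K g \<longleftrightarrow>
     (\<forall>F E a b p q r. F facet_of K \<and> E edge_of F \<and> a \<in> F \<and> b \<in> F \<and> p \<in> E \<and> q \<in> E \<and>
        b - a = r *\<^sub>R (q - p) \<longrightarrow>
        (\<forall>t\<in>{0..1}. g ((1 - t) *\<^sub>R a + t *\<^sub>R b) = (1 - t) * g a + t * g b))"

text \<open>The datum $g$ for the node $x$ is given together with a continuous $H^1$ extension into the
  elements, so that $\eta = g$ on $\partial K$ in the sense of traces reads
  $\eta - g \in H^1_0(K)$. At a boundary node, $g$ vanishes only on the part of the boundary of
  the patch inside the domain, and is nodal on the part in the boundary of the domain.\<close>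

definition ms_boundary_datum ::
  "'a::euclidean_space set \<Rightarrow> 'a set set \<Rightarrow> 'a \<Rightarrow> ('a \<Rightarrow> real) \<Rightarrow> bool" where
  "ms_boundary_datum \<Omega> \<T> x g \<longleftrightarrow> continuous_on (closure \<Omega>) g \<and>
     (\<forall>K\<in>\<T>. g \<in> H1 (interior K) \<and> linear_along_boundary K g) \<and>
     (\<forall>y\<in>nodes \<T>. g y = (if y = x then 1 else 0)) \<and>
     (\<forall>y\<in>frontier (node_patch \<T> x). x \<in> \<Omega> \<or> y \<in> \<Omega> \<longrightarrow> g y = 0)"

definition ms_function ::
  "'a::euclidean_space set \<Rightarrow> ('a \<Rightarrow> real) \<Rightarrow> 'a set set \<Rightarrow> 'a \<Rightarrow> ('a \<Rightarrow> real) \<Rightarrow> bool" where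
  "ms_function \<Omega> \<kappa> \<T> x \<eta> \<longleftrightarrow> \<eta> \<in> H1 \<Omega> \<and>
     (AE y in lebesgue_on (\<Omega> - node_patch \<T> x). \<eta> y = 0) \<and>
     (\<exists>g. ms_boundary_datum \<Omega> \<T> x g \<and>
        (\<forall>K\<in>\<T>. x extreme_point_of K \<longrightarrow>
           (\<forall>v\<in>H10 (interior K). a_form \<kappa> (interior K) \<eta> v = 0) \<and>
           (\<lambda>y. \<eta> y - g y) \<in> H10 (interior K)))"

definition ms_functions ::
  "'a::euclidean_space set \<Rightarrow> ('a \<Rightarrow> real) \<Rightarrow> 'a set set \<Rightarrow> ('a \<Rightarrow> 'a \<Rightarrow> real) \<Rightarrow> bool" where
  "ms_functions \<Omega> \<kappa> \<T> \<eta> \<longleftrightarrow> (\<forall>x\<in>nodes \<T>. ms_function \<Omega> \<kappa> \<T> x (\<eta> x)) \<and>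
     (AE y in lebesgue_on \<Omega>. (\<Sum>x\<in>nodes \<T>. \<eta> x y) = 1)"

definition aux_weight ::
  "'a::euclidean_space set \<Rightarrow> ('a \<Rightarrow> real) \<Rightarrow> 'a set set \<Rightarrow> ('a \<Rightarrow> 'a \<Rightarrow> real) \<Rightarrow> 'a \<Rightarrow> real" where
  "aux_weight \<Omega> \<kappa> \<T> \<eta> y = (\<Sum>x\<in>nodes \<T>. \<kappa> y * (norm (grad \<Omega> (\<eta> x) y))\<^sup>2)"

section \<open>Auxiliary space\<close>

text \<open>Below, $w$ stands for the weight $\tilde\kappa$, and an element is its own index.\<close>

definition s_loc ::
  "('a::euclidean_space \<Rightarrow> real) \<Rightarrow> 'a set \<Rightarrow> ('a \<Rightarrow> real) \<Rightarrow> ('a \<Rightarrow> real) \<Rightarrow> real" where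
  "s_loc w K u v = (\<integral>x. w x * u x * v x \<partial>lebesgue_on K)"

definition s_form ::
  "('a::euclidean_space \<Rightarrow> real) \<Rightarrow> 'a set set \<Rightarrow> ('a \<Rightarrow> real) \<Rightarrow> ('a \<Rightarrow> real) \<Rightarrow> real" where
  "s_form w \<T> u v = (\<Sum>K\<in>\<T>. s_loc w K u v)"

definition V_restr :: "'a::euclidean_space set \<Rightarrow> 'a set \<Rightarrow> ('a \<Rightarrow> real) set" where
  "V_restr \<Omega> K = {v. \<exists>u\<in>H10 \<Omega>. AE x in lebesgue_on K. v x = u x}"

text \<open>The integrability condition says that the right-hand side of the spectral problem is a
  proper integral. Energies over $K$ are taken over its interior, which differs by a null set.\<close>

definition eigenpair ::
  "'a::euclidean_space set \<Rightarrow> ('a \<Rightarrow> real) \<Rightarrow> ('a \<Rightarrow> real) \<Rightarrow> 'a set \<Rightarrow> real \<Rightarrow> ('a \<Rightarrow> real) \<Rightarrow> bool" where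
  "eigenpair \<Omega> \<kappa> w K \<mu> \<phi> \<longleftrightarrow> \<phi> \<in> V_restr \<Omega> K \<and>
     (\<forall>v\<in>V_restr \<Omega> K. integrable (lebesgue_on K) (\<lambda>x. w x * \<phi> x * v x) \<and>
        a_form \<kappa> (interior K) \<phi> v = \<mu> * s_loc w K \<phi> v)"

text \<open>Eigenpairs are numbered from 1. The last condition says that the list is exhaustive, with
  multiplicities, so that its first entries belong to the smallest eigenvalues.\<close>

definition eigensystem ::
  "'a::euclidean_space set \<Rightarrow> ('a \<Rightarrow> real) \<Rightarrow> ('a \<Rightarrow> real) \<Rightarrow> 'a set \<Rightarrow>
   (nat \<Rightarrow> real) \<Rightarrow> (nat \<Rightarrow> 'a \<Rightarrow> real) \<Rightarrow> bool" where
  "eigensystem \<Omega> \<kappa> w K \<mu> \<phi> \<longleftrightarrow>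
     (\<forall>j\<ge>1. eigenpair \<Omega> \<kappa> w K (\<mu> j) (\<phi> j) \<and> (\<forall>x. x \<notin> K \<longrightarrow> \<phi> j x = 0)) \<and>
     (\<forall>i\<ge>1. \<forall>j\<ge>i. \<mu> i \<le> \<mu> j) \<and>
     (\<forall>i\<ge>1. \<forall>j\<ge>1. s_loc w K (\<phi> i) (\<phi> j) = (if i = j then 1 else 0)) \<and>
     (\<forall>\<nu> u. eigenpair \<Omega> \<kappa> w K \<nu> u \<longrightarrow>
        (\<exists>J c. finite J \<and> J \<subseteq> {j. 1 \<le> j \<and> \<mu> j = \<nu>} \<and>
           (AE x in lebesgue_on K. u x = (\<Sum>j\<in>J. c j * \<phi> j x))))"

definition proj_aux ::
  "('a::euclidean_space \<Rightarrow> real) \<Rightarrow> 'a set set \<Rightarrow> ('a set \<Rightarrow> nat) \<Rightarrow> ('a set \<Rightarrow> nat \<Rightarrow> 'a \<Rightarrow> real) \<Rightarrow>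
   ('a \<Rightarrow> real) \<Rightarrow> 'a \<Rightarrow> real" where
  "proj_aux w \<T> l \<phi> u x = (\<Sum>K\<in>\<T>. \<Sum>j=1..l K. s_loc w K u (\<phi> K j) * \<phi> K j x)"

section \<open>Multiscale space\<close>

primrec oversample :: "'a::euclidean_space set set \<Rightarrow> 'a set \<Rightarrow> nat \<Rightarrow> 'a set" where
  "oversample \<T> K 0 = K"
| "oversample \<T> K (Suc m) = \<Union>{L\<in>\<T>. L \<inter> oversample \<T> K m \<noteq> {}}"

definition V0 :: "'a::euclidean_space set \<Rightarrow> 'a set \<Rightarrow> ('a \<Rightarrow> real) set" where
  "V0 \<Omega> S = {v \<in> H10 \<Omega>. v \<in> H10 (interior S) \<and> (AE x in lebesgue_on (\<Omega> - S). v x = 0)}"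

definition ms_basis ::
  "'a::euclidean_space set \<Rightarrow> ('a \<Rightarrow> real) \<Rightarrow> ('a \<Rightarrow> real) \<Rightarrow> 'a set set \<Rightarrow> ('a set \<Rightarrow> nat) \<Rightarrow>
   ('a set \<Rightarrow> nat \<Rightarrow> 'a \<Rightarrow> real) \<Rightarrow> nat \<Rightarrow> ('a set \<Rightarrow> nat \<Rightarrow> 'a \<Rightarrow> real) \<Rightarrow> bool" where
  "ms_basis \<Omega> \<kappa> w \<T> l \<phi> m \<psi> \<longleftrightarrow>
     (\<forall>K\<in>\<T>. \<forall>j\<in>{1..l K}. \<psi> K j \<in> V0 \<Omega> (oversample \<T> K m) \<and>
        (\<forall>v\<in>V0 \<Omega> (oversample \<T> K m).
           a_form \<kappa> \<Omega> (\<psi> K j) v + s_form w \<T> (proj_aux w \<T> l \<phi> (\<psi> K j)) (proj_aux w \<T> l \<phi> v)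
           = s_form w \<T> (\<phi> K j) v))"

definition V_ms ::
  "'a::euclidean_space set \<Rightarrow> 'a set set \<Rightarrow> ('a set \<Rightarrow> nat) \<Rightarrow>
   ('a set \<Rightarrow> nat \<Rightarrow> 'a \<Rightarrow> real) \<Rightarrow> ('a \<Rightarrow> real) set" where
  "V_ms \<Omega> \<T> l \<psi> =
     {v. \<exists>c. AE x in lebesgue_on \<Omega>. v x = (\<Sum>K\<in>\<T>. \<Sum>j=1..l K. c K j * \<psi> K j x)}"

end

theory Submission
  imports Defs
begin

text \<open>
  The proof is an energy argument. Let $d^n = (u^n - u^{n-1})/\Delta t$. Testing the scheme with
  $u^{n+1} - u^{n-1} = \Delta t\,(d^{n+1} + d^n)$ makes the quantity
  $E^n = \alpha \|d^n\|^2 + a(u^n, u^{n-1})$ telescope: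
  \[ E^{n+1} - E^n + \tfrac12 \Delta t\, \|d^{n+1} + d^n\|^2 = \Delta t\, (f^n, d^{n+1} + d^n). \]
  The CFL condition makes it an energy. By polarization $a(u^n, u^{n-1})$ is the mean of
  $\|u^n\|_a^2$ and $\|u^{n-1}\|_a^2$ minus $\tfrac12 (\Delta t)^2 \|d^n\|_a^2$, and
  $\|d^n\|_a^2 \le \beta\, C_{\mathrm{inv}}^2 H^{-2} \|d^n\|^2$ by the inverse inequality. Hence
  $E^n \ge \delta \|d^n\|^2 + \tfrac12 \|u^n\|_a^2$, so the load term is at most
  $\delta^{-1/2} \Delta t\, \|f^n\| (\sqrt{E^{n+1}} + \sqrt{E^n})$, and after division
  $\sqrt{E^{n+1}} \le \sqrt{E^n} + \delta^{-1/2} \Delta t\, \|f^n\|$. Summation gives the estimate.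
  This part, \<open>leapfrog.stability\<close>, concerns two semi-inner products on a linear space of functions.

  It remains to see that the $L^2$ product and the form $a$ are such products on $V_{\mathrm{ms}}$. The
  issue is linearity of $a$: the gradient is a representative chosen for each function separately, so
  additivity requires that weak gradients be unique almost everywhere (\<open>has_weak_gradient_unique\<close>).
  This is the fundamental lemma of the calculus of variations, for which enough test functions have to
  be produced. Smooth bumps that converge to the indicators of boxes suffice
  (\<open>box_bump_tendsto\<close>).
\<close>

section \<open>Semi-inner products on spaces of functions\<close>

text \<open>Both the $L^2$ product and the energy form are symmetric, bilinear and nonnegative on sets of
  functions that are linear spaces under pointwise operations. Definiteness fails, because functions
  that agree almost everywhere are not identified. Linearity is stated for a combination of two
  functions because a pointwise combination is then a single term, which serves as a rewrite rule.\<close>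

locale semi_inner_on =
  fixes V :: "('a \<Rightarrow> real) set" and ip :: "('a \<Rightarrow> real) \<Rightarrow> ('a \<Rightarrow> real) \<Rightarrow> real"
  assumes lin_closed: "u \<in> V \<Longrightarrow> v \<in> V \<Longrightarrow> (\<lambda>x. c * u x + d * v x) \<in> V"
    and lin: "u \<in> V \<Longrightarrow> v \<in> V \<Longrightarrow> w \<in> V \<Longrightarrow> ip (\<lambda>x. c * u x + d * v x) w = c * ip u w + d * ip v w"
    and sym: "u \<in> V \<Longrightarrow> v \<in> V \<Longrightarrow> ip u v = ip v u"
    and nonneg: "u \<in> V \<Longrightarrow> 0 \<le> ip u u"
begin

lemma lin_right:
  assumes "u \<in> V" "v \<in> V" "w \<in> V"
  shows "ip w (\<lambda>x. c * u x + d * v x) = c * ip w u + d * ip w v"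
  using assms sym[of w "\<lambda>x. c * u x + d * v x"] sym[of w u] sym[of w v]
  by (simp add: lin lin_closed)

lemma square:
  assumes "u \<in> V" "v \<in> V"
  shows "ip (\<lambda>x. c * u x + d * v x) (\<lambda>x. c * u x + d * v x)
    = c\<^sup>2 * ip u u + 2 * c * d * ip u v + d\<^sup>2 * ip v v"
  using assms sym[OF assms]
  by (simp add: lin lin_right lin_closed power2_eq_square algebra_simps)

text \<open>Nonnegativity of the quadratic form $c^2 (u, u) + 2cd\,(u, v) + d^2 (v, v)$ at $c = (v, v)$ and
  $d = -(u, v)$. If $(v, v) = 0$ this choice is void; then the form is affine in $d$ for $c = 1$, so its
  slope $2(u, v)$ must vanish.\<close>

lemma Cauchy_Schwarz_square:
  assumes "u \<in> V" "v \<in> V"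
  shows "(ip u v)\<^sup>2 \<le> ip u u * ip v v"
proof -
  have q: "0 \<le> c\<^sup>2 * ip u u + 2 * c * d * ip u v + d\<^sup>2 * ip v v" for c d
    using nonneg[OF lin_closed[OF assms, of c d]] square[OF assms] by simp
  show ?thesis
  proof (cases "ip v v = 0")
    case True
    have "ip u v = 0"
    proof (rule ccontr)
      assume "ip u v \<noteq> 0"
      \<comment> \<open>The value of $d$ at which the affine function equals $-1$.\<close>
      moreover define t where "t = - (ip u u + 1) / (2 * ip u v)"
      ultimately have "2 * 1 * t * ip u v = - (ip u u + 1)" by simp
      with True q[of 1 t] show False by simp
    qed
    then show ?thesis by (simp add: True)
  next
    case False
    with nonneg[OF assms(2)] have "0 < ip v v" by simp
    moreover have "0 \<le> ip v v * (ip u u * ip v v - (ip u v)\<^sup>2)"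
      using q[of "ip v v" "- ip u v"] by (simp add: power2_eq_square algebra_simps)
    ultimately show ?thesis
      by (simp add: zero_le_mult_iff)
  qed
qed

lemma Cauchy_Schwarz:
  assumes "u \<in> V" "v \<in> V"
  shows "ip u v \<le> sqrt (ip u u) * sqrt (ip v v)"
  using Cauchy_Schwarz_square[OF assms] by (subst real_sqrt_mult[symmetric]) (rule real_le_rsqrt)

lemma triangle:
  assumes "u \<in> V" "v \<in> V" "0 \<le> c"
  shows "sqrt (ip (\<lambda>x. c * u x + c * v x) (\<lambda>x. c * u x + c * v x))
    \<le> c * (sqrt (ip u u) + sqrt (ip v v))"
proof (rule real_le_lsqrt)
  have "c\<^sup>2 * (2 * ip u v) \<le> c\<^sup>2 * (2 * (sqrt (ip u u) * sqrt (ip v v)))"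
    using Cauchy_Schwarz[OF assms(1,2)] by (intro mult_left_mono) auto
  then show "ip (\<lambda>x. c * u x + c * v x) (\<lambda>x. c * u x + c * v x)
      \<le> (c * (sqrt (ip u u) + sqrt (ip v v)))\<^sup>2"
    using assms nonneg by (simp add: square power_mult_distrib power2_sum algebra_simps power2_eq_square[of c])
qed (use assms nonneg in auto)

end

lemma semi_inner_on_subset:
  assumes "semi_inner_on W ip" "V \<subseteq> W"
    and "\<And>u v c d. u \<in> V \<Longrightarrow> v \<in> V \<Longrightarrow> (\<lambda>x. c * u x + d * v x) \<in> V"
  shows "semi_inner_on V ip"
proof -
  interpret semi_inner_on W ip by fact
  show ?thesis
  proof
    show "ip u v = ip v u" if "u \<in> V" "v \<in> V" for u v
      by (rule sym) (use that assms(2) in auto)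
  qed (use assms(2,3) in \<open>blast intro: lin nonneg\<close>)+
qed

section \<open>Discrete energy estimate for the leapfrog scheme\<close>

text \<open>Division of $e' - e = (\sqrt{e'} - \sqrt{e})(\sqrt{e'} + \sqrt{e})$ by $\sqrt{e'} + \sqrt{e}$. It
  turns a load that enters through norms into growth of the root of the energy that is additive, and
  so avoids a factor that grows exponentially with the number of steps.\<close>

lemma sqrt_le_of_difference_le:
  fixes e e' c :: real
  assumes "0 \<le> e" "0 \<le> e'" "0 \<le> c" "e' - e \<le> c * (sqrt e' + sqrt e)"
  shows "sqrt e' \<le> sqrt e + c"
proof (rule ccontr)
  assume "\<not> ?thesis"
  then have gap: "c < sqrt e' - sqrt e" by simp
  moreover have "0 < sqrt e' + sqrt e"
    using gap assms(3) real_sqrt_ge_zero[OF assms(1)] by linarith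
  ultimately have "c * (sqrt e' + sqrt e) < (sqrt e' - sqrt e) * (sqrt e' + sqrt e)"
    by (rule mult_strict_right_mono)
  with assms show False
    by (simp add: algebra_simps)
qed

text \<open>The scheme in abstract form, $m((u^{n+1} - u^{n-1})/(2\tau) + \alpha\,(u^{n+1} - 2u^n + u^{n-1})/\tau^2, v)
  + a(u^n, v) = \ell_n(v)$. Here $q$ bounds the Rayleigh quotients of $a$ relative to $m$, so
  $q = \beta\, C_{\mathrm{inv}}^2 H^{-2}$ in the application, and $\rho_n$ is the dual norm of the load.\<close>

locale leapfrog =
  M: semi_inner_on V mass + A: semi_inner_on V a
  for V :: "('a \<Rightarrow> real) set" and mass a +
  fixes \<alpha> \<delta> \<tau> q :: real and N :: nat
    and u :: "nat \<Rightarrow> 'a \<Rightarrow> real" and load :: "nat \<Rightarrow> ('a \<Rightarrow> real) \<Rightarrow> real" and \<rho> :: "nat \<Rightarrow> real"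
  assumes \<alpha>: "0 < \<alpha>" and \<delta>: "0 < \<delta>" and \<tau>: "0 < \<tau>"
    and inverse_ineq: "v \<in> V \<Longrightarrow> a v v \<le> q * mass v v"
    and CFL: "\<delta> \<le> \<alpha> - q * \<tau>\<^sup>2 / 2"
    and u_in: "n \<le> N \<Longrightarrow> u n \<in> V"
    and load_le: "n \<in> {1..<N} \<Longrightarrow> v \<in> V \<Longrightarrow> load n v \<le> \<rho> n * sqrt (mass v v)"
    and \<rho>_nonneg: "n \<le> N \<Longrightarrow> 0 \<le> \<rho> n"
    and scheme: "n \<in> {1..<N} \<Longrightarrow> v \<in> V \<Longrightarrow>
      mass (\<lambda>x. (u (n + 1) x - u (n - 1) x) / (2 * \<tau>)
        + \<alpha> * ((u (n + 1) x - 2 * u n x + u (n - 1) x) / \<tau>\<^sup>2)) v + a (u n) v = load n v"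
begin

definition slope :: "nat \<Rightarrow> 'a \<Rightarrow> real" where
  "slope n x = (u n x - u (n - 1) x) / \<tau>"

text \<open>The stiffness part pairs consecutive time levels. This is the quantity that telescopes when the
  scheme is tested with $u^{n+1} - u^{n-1}$, but its sign is not evident.\<close>

definition energy :: "nat \<Rightarrow> real" where
  "energy n = \<alpha> * mass (slope n) (slope n) + a (u n) (u (n - 1))"

lemma slope_eq: "slope n = (\<lambda>x. (1 / \<tau>) * u n x + (- 1 / \<tau>) * u (n - 1) x)"
  by (simp add: slope_def fun_eq_iff diff_divide_distrib)

lemma slope_in: "n \<le> N \<Longrightarrow> slope n \<in> V"
  unfolding slope_eq by (intro M.lin_closed u_in) auto

text \<open>By polarization, $2 a(u^n, u^{n-1}) = a(u^n, u^n) + a(u^{n-1}, u^{n-1}) - \tau^2 a(d^n, d^n)$ for the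
  slope $d^n$. The inverse inequality bounds the last term by $q \tau^2 m(d^n, d^n)$, and the CFL
  condition says exactly that the mass part of the energy absorbs it with $\delta\, m(d^n, d^n)$ to
  spare.\<close>

lemma energy_coercive:
  assumes "n \<le> N"
  shows "\<delta> * mass (slope n) (slope n) + (a (u n) (u n) + a (u (n - 1)) (u (n - 1))) / 2 \<le> energy n"
proof -
  let ?d = "slope n"
  have V: "u n \<in> V" "u (n - 1) \<in> V"
    using assms by (auto intro: u_in)
  have "a ?d ?d = (a (u n) (u n) - 2 * a (u n) (u (n - 1)) + a (u (n - 1)) (u (n - 1))) / \<tau>\<^sup>2"
    unfolding slope_eq A.square[OF V] using \<tau> by (simp add: power2_eq_square field_simps)
  then have "2 * a (u n) (u (n - 1)) = a (u n) (u n) + a (u (n - 1)) (u (n - 1)) - \<tau>\<^sup>2 * a ?d ?d"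
    using \<tau> by simp
  moreover have "\<tau>\<^sup>2 * a ?d ?d \<le> \<tau>\<^sup>2 * (q * mass ?d ?d)"
    using inverse_ineq[OF slope_in[OF assms]] by (intro mult_left_mono) auto
  moreover have "\<delta> * mass ?d ?d \<le> (\<alpha> - q * \<tau>\<^sup>2 / 2) * mass ?d ?d"
    using CFL M.nonneg[OF slope_in[OF assms]] by (intro mult_right_mono) auto
  ultimately show ?thesis
    unfolding energy_def by (simp add: algebra_simps add_divide_distrib)
qed

lemma energy_bounds:
  assumes "n \<le> N"
  shows "0 \<le> energy n" "\<delta> * mass (slope n) (slope n) \<le> energy n" "a (u n) (u n) / 2 \<le> energy n"
proof -
  have "u n \<in> V" "u (n - 1) \<in> V"
    using assms by (auto intro: u_in)
  then have "0 \<le> a (u n) (u n)" "0 \<le> a (u (n - 1)) (u (n - 1))" "0 \<le> \<delta> * mass (slope n) (slope n)"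
    using \<delta> by (auto intro!: A.nonneg M.nonneg mult_nonneg_nonneg slope_in assms)
  with energy_coercive[OF assms]
  show "0 \<le> energy n" "\<delta> * mass (slope n) (slope n) \<le> energy n" "a (u n) (u n) / 2 \<le> energy n"
    by (simp_all add: add_divide_distrib)
qed

lemma slope_norm_le:
  assumes "n \<le> N"
  shows "sqrt (mass (slope n) (slope n)) \<le> sqrt (energy n) / sqrt \<delta>"
proof -
  have "mass (slope n) (slope n) \<le> energy n / \<delta>"
    using energy_bounds(2)[OF assms] \<delta> by (simp add: field_simps)
  then show ?thesis by (subst real_sqrt_divide[symmetric]) (rule real_sqrt_le_mono)
qed

text \<open>For $v = u^{n+1} - u^{n-1} = \tau (d^{n+1} + d^n)$ the second difference is $(d^{n+1} - d^n)/\tau$, so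
  the mass term is a difference of squares; the stiffness term is $a(u^{n+1}, u^n) - a(u^n, u^{n-1})$;
  and the first-order time derivative contributes a nonnegative dissipation.\<close>

lemma energy_balance:
  assumes n: "n \<in> {1..<N}"
  defines "v \<equiv> \<lambda>x. \<tau> * slope (n + 1) x + \<tau> * slope n x"
  shows "energy (n + 1) - energy n + mass v v / (2 * \<tau>) = load n v"
proof -
  define p w z where "p = u (n + 1)" and "w = u n" and "z = u (n - 1)"
  have V: "p \<in> V" "w \<in> V" "z \<in> V"
    unfolding p_def w_def z_def using n by (auto intro: u_in)
  have v: "v = (\<lambda>x. 1 * p x + (- 1) * z x)"
    using \<tau> by (simp add: v_def slope_def p_def z_def fun_eq_iff field_simps)
  have vV: "v \<in> V"
    unfolding v by (intro M.lin_closed V)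
  \<comment> \<open>The difference quotients as nested combinations of two functions, the form to which bilinearity applies.\<close>
  have "(\<lambda>x. (p x - z x) / (2 * \<tau>) + \<alpha> * ((p x - 2 * w x + z x) / \<tau>\<^sup>2))
      = (\<lambda>x. 1 * (1 / (2 * \<tau>) * v x + \<alpha> / \<tau>\<^sup>2 * (1 * p x + 1 * z x)) + (- 2 * \<alpha> / \<tau>\<^sup>2) * w x)"
    using \<tau> unfolding v by (simp add: fun_eq_iff field_simps)
  then have "mass (\<lambda>x. (p x - z x) / (2 * \<tau>) + \<alpha> * ((p x - 2 * w x + z x) / \<tau>\<^sup>2)) v
      = mass v v / (2 * \<tau>) + \<alpha> / \<tau>\<^sup>2 * (mass p v + mass z v - 2 * mass w v)"
    using V vV by (simp only: M.lin M.lin_closed) (simp add: algebra_simps)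
  \<comment> \<open>This is $m(p - w, p - w) - m(w - z, w - z)$, in which $m(w, w)$ has cancelled.\<close>
  also have "mass p v + mass z v - 2 * mass w v
      = mass p p - mass z z - 2 * mass p w + 2 * mass w z"
    unfolding v using V M.sym[of z p] M.sym[of w p] by (simp only: M.lin_right) simp
  finally have 1: "mass v v / (2 * \<tau>) + \<alpha> / \<tau>\<^sup>2 * (mass p p - mass z z - 2 * mass p w + 2 * mass w z)
      + a w v = load n v"
    using scheme[OF n vV] by (simp add: p_def w_def z_def)
  have 2: "a w v = a p w - a w z"
    unfolding v using V A.sym[of w p] by (simp only: A.lin_right)
  have sp: "slope (n + 1) = (\<lambda>x. (1 / \<tau>) * p x + (- 1 / \<tau>) * w x)"
    and sw: "slope n = (\<lambda>x. (1 / \<tau>) * w x + (- 1 / \<tau>) * z x)"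
    by (simp_all add: slope_eq p_def w_def z_def)
  have "energy (n + 1) = \<alpha> / \<tau>\<^sup>2 * (mass p p - 2 * mass p w + mass w w) + a p w"
    unfolding energy_def sp M.square[OF V(1,2)] using \<tau> by (simp add: p_def w_def power2_eq_square field_simps)
  moreover have "energy n = \<alpha> / \<tau>\<^sup>2 * (mass w w - 2 * mass w z + mass z z) + a w z"
    unfolding energy_def sw M.square[OF V(2,3)] using \<tau> by (simp add: w_def z_def power2_eq_square field_simps)
  ultimately show ?thesis
    using 1 2 by (simp add: algebra_simps add_divide_distrib)
qed

lemma energy_step:
  assumes n: "n \<in> {1..<N}"
  shows "sqrt (energy (n + 1)) \<le> sqrt (energy n) + \<tau> * \<rho> n / sqrt \<delta>"
proof (rule sqrt_le_of_difference_le)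
  define v where "v = (\<lambda>x. \<tau> * slope (n + 1) x + \<tau> * slope n x)"
  have S: "slope (n + 1) \<in> V" "slope n \<in> V"
    using n by (auto intro!: slope_in)
  have vV: "v \<in> V"
    unfolding v_def by (intro M.lin_closed S)
  have "energy (n + 1) - energy n \<le> load n v"
    using energy_balance[OF n, folded v_def] divide_nonneg_pos[OF M.nonneg[OF vV], of "2 * \<tau>"] \<tau>
    by simp
  also have "\<dots> \<le> \<rho> n * sqrt (mass v v)"
    by (rule load_le[OF n vV])
  also have "\<dots> \<le> \<rho> n * (\<tau> * (sqrt (energy (n + 1)) / sqrt \<delta> + sqrt (energy n) / sqrt \<delta>))"
  proof (rule mult_left_mono)
    have "sqrt (mass v v) \<le> \<tau> * (sqrt (mass (slope (n + 1)) (slope (n + 1))) + sqrt (mass (slope n) (slope n)))"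
      unfolding v_def using M.triangle[OF S] \<tau> by simp
    also have "\<dots> \<le> \<tau> * (sqrt (energy (n + 1)) / sqrt \<delta> + sqrt (energy n) / sqrt \<delta>)"
      using n \<tau> by (intro mult_left_mono add_mono slope_norm_le) auto
    finally show "sqrt (mass v v) \<le> \<dots>" .
  qed (use n \<rho>_nonneg in auto)
  finally show "energy (n + 1) - energy n \<le> \<tau> * \<rho> n / sqrt \<delta> * (sqrt (energy (n + 1)) + sqrt (energy n))"
    by (simp add: algebra_simps add_divide_distrib)
qed (use n energy_bounds(1) \<rho>_nonneg \<tau> \<delta> in auto)

text \<open>Only the loads before step $n$ enter; the last summand is added so that the range of summation is
  the one of the stability estimate.\<close>

lemma energy_growth:
  assumes "1 \<le> n" "n \<le> N"
  shows "sqrt (energy n) \<le> sqrt (energy 1) + \<tau> / sqrt \<delta> * (\<Sum>k=1..n. \<rho> k)"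
proof -
  have "sqrt (energy n) \<le> sqrt (energy 1) + \<tau> / sqrt \<delta> * (\<Sum>k=1..<n. \<rho> k)"
    using assms
  proof (induction n rule: dec_induct)
    case (step n)
    then show ?case
      using energy_step[of n] by (simp add: algebra_simps add_divide_distrib)
  qed simp
  also have "\<dots> \<le> sqrt (energy 1) + \<tau> / sqrt \<delta> * (\<Sum>k=1..n. \<rho> k)"
    using assms \<tau> \<delta> \<rho>_nonneg by (intro add_left_mono mult_left_mono sum_mono2) auto
  finally show ?thesis .
qed

lemma initial_energy_le:
  assumes "1 \<le> N"
  shows "sqrt (energy 1) \<le> sqrt \<alpha> * sqrt (mass (slope 1) (slope 1)) + sqrt (a (u 1) (u 1)) + sqrt (a (u 0) (u 0))"
proof (rule real_le_lsqrt)
  have V: "u 1 \<in> V" "u 0 \<in> V" "slope 1 \<in> V"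
    using assms by (auto intro: u_in slope_in)
  let ?s = "sqrt \<alpha> * sqrt (mass (slope 1) (slope 1))" and ?p = "sqrt (a (u 1) (u 1))" and ?z = "sqrt (a (u 0) (u 0))"
  have nn: "0 \<le> ?s" "0 \<le> ?p" "0 \<le> ?z"
    using V \<alpha> by (auto intro!: A.nonneg M.nonneg mult_nonneg_nonneg)
  then show "0 \<le> ?s + ?p + ?z" by simp
  have "?s\<^sup>2 = \<alpha> * mass (slope 1) (slope 1)"
    using \<alpha> V by (simp add: power_mult_distrib M.nonneg)
  then have "energy 1 \<le> ?s\<^sup>2 + ?p * ?z"
    using A.Cauchy_Schwarz[OF V(1,2)] by (simp add: energy_def)
  also have "\<dots> \<le> (?s + ?p + ?z)\<^sup>2"
  proof -
    have "x\<^sup>2 + y * z \<le> (x + y + z)\<^sup>2" if "0 \<le> x" "0 \<le> y" "0 \<le> z" for x y z :: real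
    proof -
      have "(x + y + z)\<^sup>2 = x\<^sup>2 + y * z + (y\<^sup>2 + z\<^sup>2 + y * z + 2 * (x * y) + 2 * (x * z))"
        by (simp add: power2_eq_square algebra_simps)
      with that show ?thesis by simp
    qed
    then show ?thesis using nn by blast
  qed
  finally show "energy 1 \<le> (?s + ?p + ?z)\<^sup>2" .
qed

text \<open>The energy dominates $\delta\, m(d^n, d^n)$ and $a(u^n, u^n)/2$, which gives the factor
  $\alpha/\sqrt{\delta} + \sqrt{2}$. The other factor is a common upper bound of the coefficients of
  the data: $1/\sqrt{\delta}$ for the loads, $1/\sqrt{\alpha}$ for the initial slope, since
  $\sqrt{\alpha}\,\|d^1\| = \alpha\,\|d^1\|/\sqrt{\alpha}$, and $1$ for the initial energies.\<close>

lemma stability: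
  assumes n: "n \<in> {1..N}"
  shows "\<alpha> * sqrt (mass (slope n) (slope n)) + sqrt (a (u n) (u n))
    \<le> (\<alpha> / sqrt \<delta> + sqrt 2) * (1 + 1 / sqrt \<alpha> + 1 / sqrt \<delta>) *
      (\<tau> * (\<Sum>k=1..n. \<rho> k) + \<alpha> * sqrt (mass (slope 1) (slope 1)) + sqrt (a (u 1) (u 1)) + sqrt (a (u 0) (u 0)))"
proof -
  let ?c = "1 + 1 / sqrt \<alpha> + 1 / sqrt \<delta>"
  let ?r = "\<tau> * (\<Sum>k=1..n. \<rho> k)" and ?s = "\<alpha> * sqrt (mass (slope 1) (slope 1))"
  let ?p = "sqrt (a (u 1) (u 1))" and ?z = "sqrt (a (u 0) (u 0))"
  have V: "u 1 \<in> V" "u 0 \<in> V" "slope 1 \<in> V"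
    using n by (auto intro: u_in slope_in)
  have nn: "0 \<le> ?r" "0 \<le> ?s" "0 \<le> ?p" "0 \<le> ?z" "0 < 1 / sqrt \<alpha>" "0 < 1 / sqrt \<delta>"
    using V \<alpha> \<delta> \<tau> n by (auto intro!: A.nonneg M.nonneg mult_nonneg_nonneg sum_nonneg \<rho>_nonneg)
  have "sqrt (a (u n) (u n)) \<le> sqrt (2 * energy n)"
    using energy_bounds(3)[of n] n by simp
  then have "\<alpha> * sqrt (mass (slope n) (slope n)) + sqrt (a (u n) (u n))
      \<le> \<alpha> * (sqrt (energy n) / sqrt \<delta>) + sqrt 2 * sqrt (energy n)"
    using n \<alpha> by (intro add_mono mult_left_mono slope_norm_le) (auto simp: real_sqrt_mult)
  also have "\<dots> = (\<alpha> / sqrt \<delta> + sqrt 2) * sqrt (energy n)"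
    by (simp add: algebra_simps)
  also have "\<dots> \<le> (\<alpha> / sqrt \<delta> + sqrt 2) * (?c * (?r + ?s + ?p + ?z))"
  proof (rule mult_left_mono)
    have "sqrt \<alpha> * sqrt (mass (slope 1) (slope 1)) = 1 / sqrt \<alpha> * ?s"
      using \<alpha> by (simp add: field_simps)
    then have "sqrt (energy n) \<le> 1 / sqrt \<alpha> * ?s + 1 * ?p + 1 * ?z + 1 / sqrt \<delta> * ?r"
      using energy_growth[of n] initial_energy_le n by simp
    also have "\<dots> \<le> ?c * ?s + ?c * ?p + ?c * ?z + ?c * ?r"
      using nn by (intro add_mono mult_right_mono) auto
    finally show "sqrt (energy n) \<le> ?c * (?r + ?s + ?p + ?z)"
      by (simp add: algebra_simps)
  qed (use \<alpha> \<delta> in auto)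
  finally show ?thesis by (simp add: mult.assoc)
qed

end

section \<open>Smooth approximations of indicators of boxes\<close>

text \<open>The functions $e^{-1/t}/t^n$, extended by zero to $t \le 0$. Carrying the powers of $1/t$ along makes
  the family closed under differentiation up to linear combinations, so that smoothness of the case
  $n = 0$ follows by one induction.\<close>

definition flat_exp :: "nat \<Rightarrow> real \<Rightarrow> real" where
  "flat_exp n t = (if 0 < t then exp (- 1 / t) / t ^ n else 0)"

lemma flat_exp_tendsto_0: "(flat_exp n \<longlongrightarrow> 0) (at 0)"
proof -
  have "((\<lambda>t::real. inverse t ^ n / exp (inverse t)) \<longlongrightarrow> 0) (at_right 0)"
    by (rule filterlim_compose[OF tendsto_power_div_exp_0 filterlim_inverse_at_top_right])
  moreover have "\<forall>\<^sub>F t::real in at_right 0. inverse t ^ n / exp (inverse t) = flat_exp n t"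
    by (auto simp: eventually_at_right_field flat_exp_def exp_minus field_simps intro!: exI[of _ 1])
  ultimately have right: "(flat_exp n \<longlongrightarrow> 0) (at_right 0)"
    by (rule Lim_transform_eventually)
  have "(flat_exp n \<longlongrightarrow> 0) (at_left 0)"
    by (rule tendsto_eventually) (auto simp: eventually_at_left_field flat_exp_def intro!: exI[of _ "-1"])
  with right show ?thesis
    by (simp add: filterlim_split_at)
qed

lemma DERIV_flat_exp:
  "(flat_exp n has_real_derivative flat_exp (n + 2) t - real n * flat_exp (Suc n) t) (at t)"
proof (cases t "0::real" rule: linorder_cases)
  case less
  have "((\<lambda>_. 0) has_real_derivative 0) (at t)" by simp
  then have "(flat_exp n has_real_derivative 0) (at t)"
    by (rule has_field_derivative_transform_within_open[where S = "{..<0}"])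
      (use less in \<open>auto simp: flat_exp_def\<close>)
  with less show ?thesis by (simp add: flat_exp_def)
next
  case equal
  \<comment> \<open>The difference quotient at zero is the next member of the family.\<close>
  have "((\<lambda>h. (flat_exp n h - flat_exp n 0) / (h - 0)) \<longlongrightarrow> 0) (at 0)"
    by (rule Lim_transform_eventually[OF flat_exp_tendsto_0[of "Suc n"]])
      (auto simp: eventually_at flat_exp_def intro!: exI[of _ 1])
  then have "(flat_exp n has_real_derivative 0) (at 0)"
    by (simp add: has_field_derivative_iff)
  with equal show ?thesis by (simp add: flat_exp_def)
next
  case greater
  have "((\<lambda>t. exp (- 1 / t) / t ^ n) has_real_derivative
      flat_exp (n + 2) t - real n * flat_exp (Suc n) t) (at t)"
    using greater
    by (auto intro!: derivative_eq_intros simp: flat_exp_def, cases n)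
      (auto simp: field_simps power2_eq_square)
  then show ?thesis
    by (rule has_field_derivative_transform_within_open[where S = "{0<..}"])
      (use greater in \<open>auto simp: flat_exp_def\<close>)
qed

lemma Ck_SucD: "Ck (Suc k) f \<Longrightarrow> Ck k f"
proof (induction k arbitrary: f)
  case 0
  then show ?case
    by (auto simp: continuous_on_eq_continuous_at intro: differentiable_imp_continuous_within)
qed auto

lemma Ck_const: "Ck k (\<lambda>_. c)"
  by (induction k arbitrary: c) auto

lemma Ck_SucI:
  assumes "\<And>x. (f has_derivative f' x) (at x)" and "\<And>b. b \<in> Basis \<Longrightarrow> Ck k (\<lambda>x. f' x b)"
  shows "Ck (Suc k) f"
proof -
  have "frechet_derivative f (at x) = f' x" for x
    using frechet_derivative_at[OF assms(1)] by simp
  with assms show ?thesis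
    by (auto simp: differentiable_def)
qed

lemma Ck_add:
  assumes "Ck k f" "Ck k g"
  shows "Ck k (\<lambda>x. f x + g x)"
  using assms
proof (induction k arbitrary: f g)
  case (Suc k)
  show ?case
    by (rule Ck_SucI[where f' = "\<lambda>x h. frechet_derivative f (at x) h + frechet_derivative g (at x) h"])
      (use Suc in \<open>auto intro!: has_derivative_add simp: frechet_derivative_works[symmetric]\<close>)
qed (auto intro: continuous_intros)

lemma Ck_mult:
  assumes "Ck k f" "Ck k g"
  shows "Ck k (\<lambda>x. f x * g x)"
  using assms
proof (induction k arbitrary: f g)
  case (Suc k)
  show ?case
  proof (rule Ck_SucI)
    show "((\<lambda>x. f x * g x) has_derivative
        (\<lambda>h. f x * frechet_derivative g (at x) h + frechet_derivative f (at x) h * g x)) (at x)" for x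
      by (rule has_derivative_mult) (use Suc.prems in \<open>auto simp: frechet_derivative_works[symmetric]\<close>)
    show "Ck k (\<lambda>x. f x * partial_deriv b g x + partial_deriv b f x * g x)" if "b \<in> Basis" for b
      using that Suc.prems by (intro Ck_add Suc.IH Ck_SucD[OF Suc.prems(1)] Ck_SucD[OF Suc.prems(2)]) auto
  qed
qed (auto intro: continuous_intros)

lemma Ck_prod:
  assumes "\<And>i. i \<in> I \<Longrightarrow> Ck k (f i)"
  shows "Ck k (\<lambda>x. \<Prod>i\<in>I. f i x)"
  using assms by (induction I rule: infinite_finite_induct) (auto intro: Ck_const Ck_mult)

text \<open>The derivative in a fixed direction is a linear combination of functions of the same family at the
  same affine argument.\<close>

lemma Ck_flat_exp: "Ck k (\<lambda>x. flat_exp n (x \<bullet> v + c))"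
proof (induction k arbitrary: n)
  case 0
  have "isCont (flat_exp n) t" for t
    using DERIV_flat_exp by (rule DERIV_isCont)
  then have "continuous_on UNIV (flat_exp n)"
    by (simp add: continuous_on_eq_continuous_at)
  then show ?case
    unfolding Ck.simps by (rule continuous_on_compose2) (intro continuous_intros subset_UNIV)+
next
  case (Suc k)
  show ?case
  proof (rule Ck_SucI)
    fix x :: 'a
    have "((\<lambda>x. x \<bullet> v + c) has_derivative (\<lambda>h. h \<bullet> v)) (at x)"
      by (auto intro!: derivative_eq_intros)
    from has_derivative_compose[OF this DERIV_flat_exp[unfolded has_field_derivative_def]]
    show "((\<lambda>x. flat_exp n (x \<bullet> v + c)) has_derivative
        (\<lambda>h. (flat_exp (n + 2) (x \<bullet> v + c) + (- real n) * flat_exp (Suc n) (x \<bullet> v + c)) * (h \<bullet> v))) (at x)"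
      by simp
  next
    show "Ck k (\<lambda>x. (flat_exp (n + 2) (x \<bullet> v + c) + (- real n) * flat_exp (Suc n) (x \<bullet> v + c)) * (b \<bullet> v))"
      for b
      by (intro Ck_add Ck_mult Ck_const Suc.IH)
  qed
qed

text \<open>Since $e^{-1/(kt)} \to 1$ as $k \to \infty$ for every $t > 0$, a mere rescaling of the flat function
  turns the product over the faces of a box into an approximation of its indicator. The scale is
  $k + 1$ because at scale zero the function would vanish identically.\<close>

definition box_bump :: "'a::euclidean_space \<Rightarrow> 'a \<Rightarrow> nat \<Rightarrow> 'a \<Rightarrow> real" where
  "box_bump a b k x = (\<Prod>i\<in>Basis. flat_exp 0 (real (Suc k) * (x \<bullet> i - a \<bullet> i)) *
     flat_exp 0 (real (Suc k) * (b \<bullet> i - x \<bullet> i)))"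

lemma Ck_box_bump: "Ck j (box_bump a b k)"
proof -
  have "box_bump a b k = (\<lambda>x. \<Prod>i\<in>Basis.
      flat_exp 0 (x \<bullet> (real (Suc k) *\<^sub>R i) + - real (Suc k) * (a \<bullet> i)) *
      flat_exp 0 (x \<bullet> (- real (Suc k) *\<^sub>R i) + real (Suc k) * (b \<bullet> i)))"
    by (simp add: box_bump_def fun_eq_iff algebra_simps)
  then show ?thesis
    by (simp only:) (intro Ck_prod Ck_mult Ck_flat_exp)
qed

lemma flat_exp_0_bounds: "0 \<le> flat_exp 0 t" "flat_exp 0 t \<le> 1"
  by (auto simp: flat_exp_def)

lemma box_bump_bounds: "0 \<le> box_bump a b k x" "box_bump a b k x \<le> 1"
  unfolding box_bump_def
  by (auto intro!: prod_nonneg prod_le_1 mult_nonneg_nonneg mult_le_one simp: flat_exp_0_bounds)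

lemma box_bump_neq_0_iff: "box_bump a b k x \<noteq> 0 \<longleftrightarrow> x \<in> box a b"
  by (auto simp: box_bump_def box_def flat_exp_def zero_less_mult_iff)

lemma box_bump_test_function:
  assumes "cbox a b \<subseteq> U"
  shows "box_bump a b k \<in> test_functions U"
proof -
  have "closure (box a b) \<subseteq> cbox a b"
    by (meson box_subset_cbox closed_cbox closure_minimal)
  with assms show ?thesis
    by (auto simp: test_functions_def Ck_box_bump box_bump_neq_0_iff)
qed

lemma box_bump_tendsto: "(\<lambda>k. box_bump a b k x) \<longlonglongrightarrow> indicator (box a b) x"
proof (cases "x \<in> box a b")
  case True
  have "(\<lambda>k. flat_exp 0 (real (Suc k) * t)) \<longlonglongrightarrow> 1" if "0 < t" for t
  proof -
    have "(\<lambda>k. exp (- (1 / t * inverse (real (Suc k))))) \<longlonglongrightarrow> exp (- (1 / t * 0))"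
      by (intro tendsto_intros LIMSEQ_inverse_real_of_nat)
    moreover have "flat_exp 0 (real (Suc k) * t) = exp (- (1 / t * inverse (real (Suc k))))" for k
    proof -
      have "0 < real (Suc k) * t" using that by simp
      then show ?thesis by (simp add: flat_exp_def inverse_eq_divide mult.commute del: of_nat_Suc)
    qed
    ultimately show ?thesis by simp
  qed
  with True have "(\<lambda>k. box_bump a b k x) \<longlonglongrightarrow> (\<Prod>i\<in>(Basis::'a set). 1 * 1)"
    unfolding box_bump_def by (intro tendsto_prod tendsto_mult) (auto simp: box_def)
  with True show ?thesis by simp
next
  case False
  then have "box_bump a b k x = 0" for k
    using box_bump_neq_0_iff by blast
  with False show ?thesis by simp
qed

section \<open>The fundamental lemma of the calculus of variations\<close>

text \<open>Boxes generate the Borel sets and are closed under intersection, so the integral vanishes over all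
  Borel sets; the vanishing total integral covers complements. A Borel representative is used because
  Lebesgue measurable sets are not generated by boxes.\<close>

lemma AE_zero_if_box_integrals_zero:
  fixes f :: "'a::euclidean_space \<Rightarrow> real"
  assumes int: "integrable lebesgue f" and total: "(\<integral>x. f x \<partial>lebesgue) = 0"
    and boxes: "\<And>a b. (\<integral>x. indicator (box a b) x * f x \<partial>lebesgue) = 0"
  shows "AE x in lebesgue. f x = 0"
proof -
  obtain g where g [measurable]: "g \<in> borel_measurable lborel" and fg: "AE x in lborel. f x = g x"
    using completion_ex_borel_measurable_real[of f lborel] int by auto
  have f_meas [measurable]: "f \<in> borel_measurable lebesgue"
    using int by auto
  have g_leb [measurable]: "g \<in> borel_measurable lebesgue"
    using g by (rule measurable_completion)
  have fg': "AE x in lebesgue. f x = g x"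
    using fg by (rule AE_completion)
  have "integrable lebesgue g"
    using integrable_cong_AE[OF f_meas g_leb fg'] int by simp
  then have g_int: "integrable lborel g"
    using g by (simp add: integrable_completion)
  have sg: "set_lebesgue_integral lborel A g = (\<integral>x. indicator A x * f x \<partial>lebesgue)"
    if [measurable]: "A \<in> sets borel" for A
  proof -
    have "set_lebesgue_integral lborel A g = (\<integral>x. indicator A x * g x \<partial>lebesgue)"
      unfolding set_lebesgue_integral_def by (subst integral_completion) simp_all
    also have "\<dots> = (\<integral>x. indicator A x * f x \<partial>lebesgue)"
    proof (rule integral_cong_AE)
      have [measurable]: "A \<in> sets lebesgue" by simp
      show "(\<lambda>x. indicator A x * g x) \<in> borel_measurable lebesgue"
        and "(\<lambda>x. indicator A x * f x) \<in> borel_measurable lebesgue"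
        by measurable
    qed (use fg' in auto)
    finally show ?thesis .
  qed
  have "set_lebesgue_integral lborel A g = 0" if "A \<in> sets lborel" for A
  proof -
    have "Int_stable (range (\<lambda>(a, b). box a b :: 'a set))" "range (\<lambda>(a, b). box a b :: 'a set) \<subseteq> Pow UNIV"
      and "A \<in> sigma_sets UNIV (range (\<lambda>(a, b). box a b))"
      using that by (auto simp: borel_eq_box Int_stable_def box_Int_box)
    then show ?thesis
    proof (induction rule: sigma_sets_induct_disjoint)
      case (basic A)
      then show ?case by (auto simp: sg boxes)
    next
      case empty
      show ?case by (simp add: set_lebesgue_integral_def)
    next
      case (compl A)
      then have A: "A \<in> sets borel" by (simp add: borel_eq_box)
      then have "integrable lborel (\<lambda>x. indicator A x *\<^sub>R g x)"
        using g_int by (intro integrable_mult_indicator) auto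
      moreover have "(\<integral>x. g x \<partial>lborel) = 0"
        using sg[of UNIV] total by (simp add: set_lebesgue_integral_def)
      moreover have "indicator (UNIV - A) x *\<^sub>R g x = g x - indicator A x *\<^sub>R g x" for x
        by (simp split: split_indicator)
      ultimately show ?case
        using compl g_int by (simp add: set_lebesgue_integral_def)
    next
      case (union A)
      then have A: "A i \<in> sets borel" for i
        by (auto simp: borel_eq_box)
      have "set_integrable lborel (\<Union>i. A i) g"
        unfolding set_integrable_def using A g_int by (intro integrable_mult_indicator) auto
      then have "set_lebesgue_integral lborel (\<Union>i. A i) g = (\<Sum>i. set_lebesgue_integral lborel (A i) g)"
        using A union.hyps(1)
        by (intro lebesgue_integral_countable_add) (auto simp: disjoint_family_on_def)
      with union show ?case by simp
    qed
  qed
  then have "AE x in lborel. g x = 0"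
    using g_int by (intro sigma_finite_measure.density_zero[OF sigma_finite_lborel])
  with fg have "AE x in lborel. f x = 0" by auto
  then show ?thesis by (rule AE_completion)
qed

text \<open>Dominated convergence along the bump functions of a box replaces the test function by the indicator
  of the box. This works for boxes whose closure lies in $U$, and countably many of these cover $U$.\<close>

lemma fundamental_lemma_of_calculus_of_variations:
  fixes f :: "'a::euclidean_space \<Rightarrow> real"
  assumes U: "open U" and loc: "\<And>a b. cbox a b \<subseteq> U \<Longrightarrow> integrable (lebesgue_on (cbox a b)) f"
    and zero: "\<And>\<phi>. \<phi> \<in> test_functions U \<Longrightarrow> (\<integral>x. f x * \<phi> x \<partial>lebesgue_on U) = 0"
  shows "AE x in lebesgue_on U. f x = 0"
proof -
  have int: "integrable lebesgue (\<lambda>x. indicator (cbox a b) x * f x)" if "cbox a b \<subseteq> U" for a b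
    using loc[OF that] by (simp add: integrable_restrict_space)
  have box: "integrable lebesgue (\<lambda>x. indicator (box a b) x * f x)
      \<and> (\<integral>x. indicator (box a b) x * f x \<partial>lebesgue) = 0" if ab: "cbox a b \<subseteq> U" for a b
  proof
    define F where "F = (\<lambda>x. indicator (cbox a b) x * f x)"
    have F: "integrable lebesgue F"
      unfolding F_def using int[OF ab] .
    then have [measurable]: "F \<in> borel_measurable lebesgue" by simp
    have [measurable]: "box_bump a b k \<in> borel_measurable lebesgue" for k
      using Ck_box_bump[of 0 a b k] by (auto intro: continuous_imp_measurable_on_sets_lebesgue[of UNIV, simplified lebesgue_on_UNIV_eq])
    have iF: "indicator (box a b) x * F x = indicator (box a b) x * f x" for x
      using box_subset_cbox[of a b] by (auto simp: F_def split: split_indicator)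
    have "integrable lebesgue (\<lambda>x. indicator (box a b) x *\<^sub>R F x)"
      by (rule integrable_mult_indicator) (auto intro: F)
    then show "integrable lebesgue (\<lambda>x. indicator (box a b) x * f x)"
      by (simp add: iF)
    have "(\<integral>x. box_bump a b k x * F x \<partial>lebesgue) = 0" for k
    proof -
      have "(\<integral>x. box_bump a b k x * F x \<partial>lebesgue)
          = (\<integral>x. indicator U x *\<^sub>R (f x * box_bump a b k x) \<partial>lebesgue)"
      proof (rule Bochner_Integration.integral_cong)
        fix x
        show "box_bump a b k x * F x = indicator U x *\<^sub>R (f x * box_bump a b k x)"
          using ab box_bump_neq_0_iff[of a b k x] box_subset_cbox[of a b]
          by (auto simp: F_def split: split_indicator)
      qed simp
      also have "\<dots> = (\<integral>x. f x * box_bump a b k x \<partial>lebesgue_on U)"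
        using U by (simp add: integral_restrict_space)
      also have "\<dots> = 0"
        by (intro zero box_bump_test_function ab)
      finally show ?thesis .
    qed
    moreover have "(\<lambda>k. \<integral>x. box_bump a b k x * F x \<partial>lebesgue)
        \<longlonglongrightarrow> (\<integral>x. indicator (box a b) x * F x \<partial>lebesgue)"
    proof (rule integral_dominated_convergence)
      show "integrable lebesgue (\<lambda>x. norm (F x))" using F by (rule integrable_norm)
      show "AE x in lebesgue. (\<lambda>k. box_bump a b k x * F x) \<longlonglongrightarrow> indicator (box a b) x * F x"
        by (intro AE_I2 tendsto_mult tendsto_const box_bump_tendsto)
      show "AE x in lebesgue. norm (box_bump a b k x * F x) \<le> norm (F x)" for k
        by (intro AE_I2) (simp add: abs_mult mult_left_le_one_le box_bump_bounds)
      have [measurable]: "box a b \<in> sets lebesgue" by simp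
      show "(\<lambda>x. indicator (box a b) x * F x) \<in> borel_measurable lebesgue"
        and "\<And>k. (\<lambda>x. box_bump a b k x * F x) \<in> borel_measurable lebesgue"
        by measurable
    qed
    ultimately show "(\<integral>x. indicator (box a b) x * f x \<partial>lebesgue) = 0"
      by (simp add: iF LIMSEQ_const_iff)
  qed
  have AE_cbox: "AE x in lebesgue. x \<in> cbox a b \<longrightarrow> f x = 0" if ab: "cbox a b \<subseteq> U" for a b
  proof -
    have "AE x in lebesgue. indicator (box a b) x * f x = 0"
    proof (rule AE_zero_if_box_integrals_zero)
      fix c d
      \<comment> \<open>The intersection of two open boxes is a box whose closure is still contained in $U$.\<close>
      define a' b' :: 'a where "a' = (\<Sum>i\<in>Basis. max (c\<bullet>i) (a\<bullet>i) *\<^sub>R i)" and "b' = (\<Sum>i\<in>Basis. min (d\<bullet>i) (b\<bullet>i) *\<^sub>R i)"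
      have "box c d \<inter> box a b = box a' b'" "cbox c d \<inter> cbox a b = cbox a' b'"
        by (simp_all add: a'_def b'_def box_Int_box Int_interval)
      moreover have "cbox a' b' \<subseteq> U" using calculation ab by auto
      ultimately show "(\<integral>x. indicator (box c d) x * (indicator (box a b) x * f x) \<partial>lebesgue) = 0"
        using box[of a' b'] by (simp add: mult.assoc[symmetric] indicator_inter_arith[symmetric])
    qed (use box[OF ab] in auto)
    \<comment> \<open>The covering consists of closed boxes, so their faces have to be discarded.\<close>
    moreover have "AE x in lebesgue. x \<notin> cbox a b - box a b"
      using negligible_frontier_interval[of a b]
      by (intro AE_not_in) (simp add: negligible_iff_null_sets)
    ultimately show ?thesis
      by eventually_elim (auto split: split_indicator_asm)
  qed
  obtain \<D> where D: "countable \<D>" "\<D> \<subseteq> Pow U" "\<And>X. X \<in> \<D> \<Longrightarrow> \<exists>a b. X = cbox a b" "\<Union>\<D> = U"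
    using open_countable_Union_open_cbox[OF U] by metis
  have "AE x in lebesgue. \<forall>X\<in>\<D>. x \<in> X \<longrightarrow> f x = 0"
  proof (rule AE_ball_countable')
    fix X assume "X \<in> \<D>"
    with D show "AE x in lebesgue. x \<in> X \<longrightarrow> f x = 0"
      using AE_cbox by (metis PowD subsetD)
  qed (rule D)
  then have "AE x in lebesgue. x \<in> U \<longrightarrow> f x = 0"
    by eventually_elim (use D(4) in auto)
  then show ?thesis
    using U by (simp add: AE_restrict_space_iff)
qed

section \<open>Square-integrable functions\<close>

lemma L2_integrable_inner:
  assumes "u \<in> L2 U" "v \<in> L2 U"
  shows "integrable (lebesgue_on U) (\<lambda>x. u x \<bullet> v x)"
proof (rule Bochner_Integration.integrable_bound)
  have [measurable]: "u \<in> borel_measurable (lebesgue_on U)" "v \<in> borel_measurable (lebesgue_on U)"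
    using assms by (auto simp: L2_def)
  show "integrable (lebesgue_on U) (\<lambda>x. (norm (u x))\<^sup>2 + (norm (v x))\<^sup>2)"
    using assms by (auto simp: L2_def)
  show "(\<lambda>x. u x \<bullet> v x) \<in> borel_measurable (lebesgue_on U)"
    by measurable
  have "\<bar>u x \<bullet> v x\<bar> \<le> (norm (u x))\<^sup>2 + (norm (v x))\<^sup>2" for x
  proof -
    have "\<bar>u x \<bullet> v x\<bar> \<le> norm (u x) * norm (v x)"
      by (rule Cauchy_Schwarz_ineq2)
    also have "\<dots> \<le> (norm (u x))\<^sup>2 + (norm (v x))\<^sup>2"
      using sum_squares_bound[of "norm (u x)" "norm (v x)"]
        mult_nonneg_nonneg[OF norm_ge_zero[of "u x"] norm_ge_zero[of "v x"]] by linarith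
    finally show ?thesis .
  qed
  then show "AE x in lebesgue_on U. norm (u x \<bullet> v x) \<le> norm ((norm (u x))\<^sup>2 + (norm (v x))\<^sup>2)"
    by (intro AE_I2) (simp add: add_nonneg_nonneg)
qed

lemma L2_lin:
  assumes "u \<in> L2 U" "v \<in> L2 U"
  shows "(\<lambda>x. c *\<^sub>R u x + d *\<^sub>R v x) \<in> L2 U"
proof -
  have [measurable]: "u \<in> borel_measurable (lebesgue_on U)" "v \<in> borel_measurable (lebesgue_on U)"
    using assms by (auto simp: L2_def)
  have "integrable (lebesgue_on U) (\<lambda>x. c * c * (u x \<bullet> u x) + 2 * c * d * (u x \<bullet> v x) + d * d * (v x \<bullet> v x))"
    by (intro Bochner_Integration.integrable_add integrable_mult_right L2_integrable_inner assms)
  moreover have "c * c * (u x \<bullet> u x) + 2 * c * d * (u x \<bullet> v x) + d * d * (v x \<bullet> v x)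
      = (norm (c *\<^sub>R u x + d *\<^sub>R v x))\<^sup>2" for x
    by (simp add: power2_norm_eq_inner inner_add_left inner_add_right inner_commute algebra_simps)
  ultimately show ?thesis
    by (simp add: L2_def)
qed

text \<open>Lebesgue measure is complete, so null sets cannot destroy measurability. This matters because members
  of the multiscale space are prescribed only almost everywhere.\<close>

lemma borel_measurable_lebesgue_on_cong_AE:
  fixes u v :: "'a::euclidean_space \<Rightarrow> 'b::euclidean_space"
  assumes U: "U \<in> sets lebesgue" and u: "u \<in> borel_measurable (lebesgue_on U)"
    and ae: "AE x in lebesgue_on U. u x = v x"
  shows "v \<in> borel_measurable (lebesgue_on U)"
proof -
  have iff: "(\<lambda>x. if x \<in> U then f x else 0) \<in> borel_measurable lebesgue \<longleftrightarrow> f \<in> borel_measurable (lebesgue_on U)"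
    for f :: "'a \<Rightarrow> 'b"
    using borel_measurable_if_lebesgue_on[OF U, of UNIV f] by (simp add: lebesgue_on_UNIV_eq)
  have "AE x in lebesgue. (if x \<in> U then u x else 0) = (if x \<in> U then v x else 0)"
    using ae U by (auto simp: AE_restrict_space_iff)
  from iff[THEN iffD1, OF borel_measurable_AE[OF iff[THEN iffD2, OF u] this]] show ?thesis .
qed

lemma L2_cong_AE:
  assumes U: "U \<in> sets lebesgue" and u: "u \<in> L2 U" and ae: "AE x in lebesgue_on U. u x = v x"
  shows "v \<in> L2 U"
proof -
  have [measurable]: "u \<in> borel_measurable (lebesgue_on U)" "v \<in> borel_measurable (lebesgue_on U)"
    using borel_measurable_lebesgue_on_cong_AE[OF U _ ae] u by (auto simp: L2_def)
  have "integrable (lebesgue_on U) (\<lambda>x. (norm (v x))\<^sup>2) \<longleftrightarrow> integrable (lebesgue_on U) (\<lambda>x. (norm (u x))\<^sup>2)"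
  proof (rule integrable_cong_AE)
    show "AE x in lebesgue_on U. (norm (v x))\<^sup>2 = (norm (u x))\<^sup>2"
      using ae by eventually_elim simp
  qed measurable
  with u show ?thesis by (simp add: L2_def)
qed

text \<open>Test functions and their partial derivatives are such functions. Hence the integrals in the definition
  of a weak gradient of a square-integrable function converge and are linear in the function.\<close>

lemma continuous_compact_support_in_L2:
  fixes f :: "'a::euclidean_space \<Rightarrow> real"
  assumes U: "U \<in> sets lebesgue" and f: "continuous_on UNIV f"
    and S: "compact S" and out: "\<And>x. x \<notin> S \<Longrightarrow> f x = 0"
  shows "f \<in> L2 U"
proof -
  have "integrable lborel (\<lambda>x. indicator S x *\<^sub>R (f x)\<^sup>2)"
    using S f by (intro borel_integrable_compact continuous_intros) (auto intro: continuous_on_subset)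
  then have "integrable lebesgue (\<lambda>x. indicator S x *\<^sub>R (f x)\<^sup>2)"
    by (subst integrable_completion) auto
  then have "integrable lebesgue (\<lambda>x. indicator U x *\<^sub>R (indicator S x *\<^sub>R (f x)\<^sup>2))"
    by (rule integrable_mult_indicator[OF U])
  then have "integrable (lebesgue_on U) (\<lambda>x. indicator S x *\<^sub>R (f x)\<^sup>2)"
    using U by (simp add: integrable_restrict_space)
  moreover have "(\<lambda>x. indicator S x *\<^sub>R (f x)\<^sup>2) = (\<lambda>x. (norm (f x))\<^sup>2)"
    using out by (force simp: fun_eq_iff split: split_indicator)
  moreover have "f \<in> borel_measurable (lebesgue_on U)"
    using continuous_imp_measurable_on_sets_lebesgue[OF continuous_on_subset[OF f] U] by simp
  ultimately show ?thesis by (simp add: L2_def)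
qed

lemma test_function_in_L2:
  assumes "U \<in> sets lebesgue" "\<phi> \<in> test_functions U"
  shows "\<phi> \<in> L2 U"
proof (rule continuous_compact_support_in_L2[OF assms(1)])
  have "Ck 0 \<phi>"
    using assms(2) unfolding test_functions_def by blast
  then show "continuous_on UNIV \<phi>"
    by simp
  show "compact (closure {x. \<phi> x \<noteq> 0})"
    using assms(2) by (simp add: test_functions_def)
  show "\<phi> x = 0" if "x \<notin> closure {x. \<phi> x \<noteq> 0}" for x
    using that closure_subset[of "{x. \<phi> x \<noteq> 0}"] by auto
qed

lemma partial_deriv_test_function_in_L2:
  assumes "U \<in> sets lebesgue" "\<phi> \<in> test_functions U" "b \<in> Basis"
  shows "partial_deriv b \<phi> \<in> L2 U"
proof (rule continuous_compact_support_in_L2[OF assms(1)])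
  have "Ck (Suc 0) \<phi>"
    using assms(2) unfolding test_functions_def by blast
  then show "continuous_on UNIV (partial_deriv b \<phi>)"
    using assms(3) by simp
  show "compact (closure {x. \<phi> x \<noteq> 0})"
    using assms(2) by (simp add: test_functions_def)
  show "partial_deriv b \<phi> x = 0" if "x \<notin> closure {x. \<phi> x \<noteq> 0}" for x
  proof -
    have "frechet_derivative (\<lambda>_. 0 :: real) (at x) = frechet_derivative \<phi> (at x)"
      by (rule frechet_derivative_transform_within_open[where X = "- closure {x. \<phi> x \<noteq> 0}"])
        (use that closure_subset[of "{x. \<phi> x \<noteq> 0}"] in auto)
    then show ?thesis by (simp add: fun_eq_iff)
  qed
qed

section \<open>Weak gradients\<close>

lemma integrable_component_times_test_function:
  assumes U: "U \<in> sets lebesgue" and g: "g \<in> L2 U" and \<phi>: "\<phi> \<in> test_functions U"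
    and b: "b \<in> Basis"
  shows "integrable (lebesgue_on U) (\<lambda>x. (g x \<bullet> b) * \<phi> x)"
proof -
  have "(\<lambda>x. \<phi> x *\<^sub>R b) \<in> L2 U"
    using test_function_in_L2[OF U \<phi>] b by (auto simp: L2_def)
  from L2_integrable_inner[OF g this] show ?thesis
    by (simp add: mult.commute)
qed

lemma has_weak_gradient_lin:
  assumes U: "U \<in> sets lebesgue" and "u \<in> L2 U" "v \<in> L2 U"
    and g: "has_weak_gradient U u g" and h: "has_weak_gradient U v h"
  shows "has_weak_gradient U (\<lambda>x. c * u x + d * v x) (\<lambda>x. c *\<^sub>R g x + d *\<^sub>R h x)"
  unfolding has_weak_gradient_def
proof (intro conjI ballI)
  have gh: "g \<in> L2 U" "h \<in> L2 U"
    using g h by (auto simp: has_weak_gradient_def)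
  then show "(\<lambda>x. c *\<^sub>R g x + d *\<^sub>R h x) \<in> L2 U"
    by (rule L2_lin)
  fix \<phi> b assume \<phi>: "\<phi> \<in> test_functions U" and b: "b \<in> (Basis :: 'a set)"
  let ?D = "partial_deriv b \<phi>"
  have D: "?D \<in> L2 U"
    by (rule partial_deriv_test_function_in_L2[OF U \<phi> b])
  have int: "integrable (lebesgue_on U) (\<lambda>x. (g x \<bullet> b) * \<phi> x)"
      "integrable (lebesgue_on U) (\<lambda>x. (h x \<bullet> b) * \<phi> x)"
      "integrable (lebesgue_on U) (\<lambda>x. u x * ?D x)" "integrable (lebesgue_on U) (\<lambda>x. v x * ?D x)"
    using integrable_component_times_test_function[OF U _ \<phi> b] gh
      L2_integrable_inner[OF assms(2) D] L2_integrable_inner[OF assms(3) D]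
    by auto
  have "(\<integral>x. (c * u x + d * v x) * ?D x \<partial>lebesgue_on U)
      = (\<integral>x. c * (u x * ?D x) + d * (v x * ?D x) \<partial>lebesgue_on U)"
    by (simp add: algebra_simps)
  also have "\<dots> = c * (\<integral>x. u x * ?D x \<partial>lebesgue_on U) + d * (\<integral>x. v x * ?D x \<partial>lebesgue_on U)"
    using int by simp
  also have "\<dots> = - (c * (\<integral>x. (g x \<bullet> b) * \<phi> x \<partial>lebesgue_on U) + d * (\<integral>x. (h x \<bullet> b) * \<phi> x \<partial>lebesgue_on U))"
    using g h \<phi> b by (simp add: has_weak_gradient_def)
  also have "\<dots> = - (\<integral>x. c * ((g x \<bullet> b) * \<phi> x) + d * ((h x \<bullet> b) * \<phi> x) \<partial>lebesgue_on U)"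
    using int by simp
  also have "\<dots> = - (\<integral>x. ((c *\<^sub>R g x + d *\<^sub>R h x) \<bullet> b) * \<phi> x \<partial>lebesgue_on U)"
    by (simp add: algebra_simps inner_add_left)
  finally show "(\<integral>x. (c * u x + d * v x) * ?D x \<partial>lebesgue_on U)
      = - (\<integral>x. ((c *\<^sub>R g x + d *\<^sub>R h x) \<bullet> b) * \<phi> x \<partial>lebesgue_on U)" .
qed

lemma L2_integrable_on_cbox:
  fixes f :: "'a::euclidean_space \<Rightarrow> 'b::euclidean_space"
  assumes U: "open U" and f: "f \<in> L2 U" and ab: "cbox a b \<subseteq> U"
  shows "integrable (lebesgue_on (cbox a b)) (\<lambda>x. f x \<bullet> e)"
proof -
  have [measurable]: "f \<in> borel_measurable (lebesgue_on (cbox a b))"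
    using f ab by (auto simp: L2_def intro: measurable_restrict_mono)
  have "integrable lebesgue (\<lambda>x. indicator U x *\<^sub>R (norm (f x))\<^sup>2)"
    using f U by (simp add: L2_def integrable_restrict_space)
  then have "integrable lebesgue (\<lambda>x. indicator (cbox a b) x *\<^sub>R (indicator U x *\<^sub>R (norm (f x))\<^sup>2))"
    by (rule integrable_mult_indicator[rotated]) simp
  moreover have "(\<lambda>x. indicator (cbox a b) x *\<^sub>R (indicator U x *\<^sub>R (norm (f x))\<^sup>2))
      = (\<lambda>x. indicator (cbox a b) x *\<^sub>R (norm (f x))\<^sup>2)"
    using ab by (auto simp: fun_eq_iff split: split_indicator)
  ultimately have "integrable lebesgue (\<lambda>x. indicator (cbox a b) x *\<^sub>R (norm (f x))\<^sup>2)"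
    by (simp only:)
  then have "integrable (lebesgue_on (cbox a b)) (\<lambda>x. (norm (f x))\<^sup>2)"
    by (simp add: integrable_restrict_space)
  then have "f \<in> L2 (cbox a b)" by (simp add: L2_def)
  moreover have "integrable (lebesgue_on (cbox a b)) (\<lambda>_. (norm e)\<^sup>2)"
    by (intro finite_measure.integrable_const finite_measure_lebesgue_on) simp
  then have "(\<lambda>_. e) \<in> L2 (cbox a b)" by (simp add: L2_def)
  ultimately show ?thesis by (rule L2_integrable_inner)
qed

text \<open>The fundamental lemma applies to each component of the difference, since both gradients have the same
  integral against every test function.\<close>

lemma has_weak_gradient_unique:
  assumes U: "open U" and g: "has_weak_gradient U u g" and h: "has_weak_gradient U u h"
  shows "AE x in lebesgue_on U. g x = h x"
proof -
  have Us: "U \<in> sets lebesgue" using U by simp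
  have gh: "g \<in> L2 U" "h \<in> L2 U"
    using g h by (auto simp: has_weak_gradient_def)
  define f where "f = (\<lambda>x. 1 *\<^sub>R g x + (- 1) *\<^sub>R h x)"
  have f: "f \<in> L2 U"
    unfolding f_def using gh by (rule L2_lin)
  have "AE x in lebesgue_on U. f x \<bullet> b = 0" if b: "b \<in> Basis" for b
  proof (rule fundamental_lemma_of_calculus_of_variations[OF U])
    show "integrable (lebesgue_on (cbox p q)) (\<lambda>x. f x \<bullet> b)" if "cbox p q \<subseteq> U" for p q
      by (rule L2_integrable_on_cbox[OF U f that])
    fix \<phi> assume \<phi>: "\<phi> \<in> test_functions U"
    have "integrable (lebesgue_on U) (\<lambda>x. (g x \<bullet> b) * \<phi> x)"
        "integrable (lebesgue_on U) (\<lambda>x. (h x \<bullet> b) * \<phi> x)"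
      by (intro integrable_component_times_test_function Us gh \<phi> b)+
    moreover have "(\<integral>x. (g x \<bullet> b) * \<phi> x \<partial>lebesgue_on U) = (\<integral>x. (h x \<bullet> b) * \<phi> x \<partial>lebesgue_on U)"
      using g h \<phi> b by (simp add: has_weak_gradient_def)
    ultimately show "(\<integral>x. (f x \<bullet> b) * \<phi> x \<partial>lebesgue_on U) = 0"
      by (simp add: f_def inner_diff_left left_diff_distrib)
  qed
  then have "AE x in lebesgue_on U. \<forall>b\<in>Basis. f x \<bullet> b = 0"
    by (intro AE_ball_countable') (auto intro: countable_finite)
  then show ?thesis
    by eventually_elim (simp add: f_def euclidean_eq_iff[of "g _"] inner_diff_left)
qed

lemma has_weak_gradient_cong_AE:
  assumes U: "U \<in> sets lebesgue" and u: "u \<in> L2 U" and ae: "AE x in lebesgue_on U. u x = v x"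
    and g: "has_weak_gradient U u g"
  shows "has_weak_gradient U v g"
proof -
  have "(\<integral>x. u x * partial_deriv b \<phi> x \<partial>lebesgue_on U) = (\<integral>x. v x * partial_deriv b \<phi> x \<partial>lebesgue_on U)"
    if "\<phi> \<in> test_functions U" "b \<in> Basis" for \<phi> b
  proof (rule integral_cong_AE)
    have [measurable]: "u \<in> borel_measurable (lebesgue_on U)" "v \<in> borel_measurable (lebesgue_on U)"
        "partial_deriv b \<phi> \<in> borel_measurable (lebesgue_on U)"
      using u L2_cong_AE[OF U u ae] partial_deriv_test_function_in_L2[OF U that] by (auto simp: L2_def)
    show "(\<lambda>x. u x * partial_deriv b \<phi> x) \<in> borel_measurable (lebesgue_on U)"
      "(\<lambda>x. v x * partial_deriv b \<phi> x) \<in> borel_measurable (lebesgue_on U)"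
      by measurable
    show "AE x in lebesgue_on U. u x * partial_deriv b \<phi> x = v x * partial_deriv b \<phi> x"
      using ae by eventually_elim simp
  qed
  with g show ?thesis by (simp add: has_weak_gradient_def)
qed

lemma H1_cong_AE:
  assumes "U \<in> sets lebesgue" "u \<in> H1 U" "AE x in lebesgue_on U. u x = v x"
  shows "v \<in> H1 U"
  using assms has_weak_gradient_cong_AE[OF assms(1) _ assms(3)] L2_cong_AE[OF assms(1) _ assms(3)]
  by (auto simp: H1_def)

lemma has_weak_gradient_grad: "u \<in> H1 U \<Longrightarrow> has_weak_gradient U u (grad U u)"
  using someI_ex[of "has_weak_gradient U u"] by (simp add: grad_def H1_def)

lemma H1_subset_L2: "H1 U \<subseteq> L2 U"
  by (auto simp: H1_def)

lemma grad_in_L2: "u \<in> H1 U \<Longrightarrow> grad U u \<in> L2 U"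
  using has_weak_gradient_grad by (auto simp: has_weak_gradient_def)

lemma L2_real_lin:
  fixes u v :: "'a::euclidean_space \<Rightarrow> real"
  shows "u \<in> L2 U \<Longrightarrow> v \<in> L2 U \<Longrightarrow> (\<lambda>x. c * u x + d * v x) \<in> L2 U"
  using L2_lin[of u U v c d] by simp

lemma H1_lin:
  assumes "U \<in> sets lebesgue" "u \<in> H1 U" "v \<in> H1 U"
  shows "(\<lambda>x. c * u x + d * v x) \<in> H1 U"
proof -
  have L: "u \<in> L2 U" "v \<in> L2 U"
    using assms by (auto simp: H1_def)
  from has_weak_gradient_lin[OF assms(1) L has_weak_gradient_grad[OF assms(2)] has_weak_gradient_grad[OF assms(3)]]
  show ?thesis
    using L2_real_lin[OF L] unfolding H1_def by blast
qed

text \<open>The chosen representatives of the three gradients are unrelated as functions. Uniqueness compares the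
  one of the combination with the combination of the other two.\<close>

lemma grad_lin:
  assumes U: "open U" and uv: "u \<in> H1 U" "v \<in> H1 U"
  shows "AE x in lebesgue_on U. grad U (\<lambda>x. c * u x + d * v x) x = c *\<^sub>R grad U u x + d *\<^sub>R grad U v x"
proof (rule has_weak_gradient_unique[OF U])
  have Us: "U \<in> sets lebesgue" using U by simp
  show "has_weak_gradient U (\<lambda>x. c * u x + d * v x) (grad U (\<lambda>x. c * u x + d * v x))"
    by (intro has_weak_gradient_grad H1_lin Us uv)
  show "has_weak_gradient U (\<lambda>x. c * u x + d * v x) (\<lambda>x. c *\<^sub>R grad U u x + d *\<^sub>R grad U v x)"
    using uv by (intro has_weak_gradient_lin has_weak_gradient_grad Us) (auto simp: H1_def)
qed

lemma zero_in_H1: "(\<lambda>_. 0) \<in> H1 U"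
proof -
  have "has_weak_gradient U (\<lambda>_. 0) (\<lambda>_. 0)"
    by (simp add: has_weak_gradient_def L2_def)
  then show ?thesis by (auto simp: H1_def L2_def)
qed

lemma H1_sum:
  assumes "U \<in> sets lebesgue" "\<And>i. i \<in> I \<Longrightarrow> u i \<in> H1 U"
  shows "(\<lambda>x. \<Sum>i\<in>I. c i * u i x) \<in> H1 U"
  using assms(2)
proof (induction I rule: infinite_finite_induct)
  case (insert i I)
  then have "(\<lambda>x. c i * u i x + 1 * (\<Sum>i\<in>I. c i * u i x)) \<in> H1 U"
    by (intro H1_lin assms(1)) auto
  with insert show ?case by simp
qed (auto simp: zero_in_H1)

section \<open>The mass and energy forms\<close>

lemma semi_inner_on_L2: "semi_inner_on (L2 U) (L2_inner U)"
proof
  fix u v w :: "'a \<Rightarrow> real" and c d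
  assume L: "u \<in> L2 U" "v \<in> L2 U"
  then show "(\<lambda>x. c * u x + d * v x) \<in> L2 U" by (rule L2_real_lin)
  show "L2_inner U u v = L2_inner U v u"
    by (simp add: L2_inner_def mult.commute)
  show "0 \<le> L2_inner U u u"
    by (simp add: L2_inner_def)
  assume w: "w \<in> L2 U"
  have "integrable (lebesgue_on U) (\<lambda>x. u x * w x)" "integrable (lebesgue_on U) (\<lambda>x. v x * w x)"
    using L2_integrable_inner[OF L(1) w] L2_integrable_inner[OF L(2) w] by auto
  then show "L2_inner U (\<lambda>x. c * u x + d * v x) w = c * L2_inner U u w + d * L2_inner U v w"
    by (simp add: L2_inner_def distrib_right mult.assoc)
qed

lemma coefficient_bounds:
  assumes "coefficient U \<kappa> \<gamma> \<beta>"
  shows "AE x in lebesgue_on U. 0 < \<kappa> x \<and> \<kappa> x \<le> \<beta>"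
proof -
  have "AE x in lebesgue_on U. \<gamma> \<le> \<kappa> x \<and> \<kappa> x \<le> \<beta>"
    using assms by (simp add: coefficient_def)
  then show ?thesis
    by eventually_elim (use assms in \<open>auto simp: coefficient_def\<close>)
qed

lemma weighted_inner_integrable:
  assumes \<kappa>: "coefficient U \<kappa> \<gamma> \<beta>" and gh: "g \<in> L2 U" "h \<in> L2 U"
  shows "integrable (lebesgue_on U) (\<lambda>x. \<kappa> x * (g x \<bullet> h x))"
proof (rule Bochner_Integration.integrable_bound)
  have [measurable]: "\<kappa> \<in> borel_measurable (lebesgue_on U)" "g \<in> borel_measurable (lebesgue_on U)"
      "h \<in> borel_measurable (lebesgue_on U)"
    using assms by (auto simp: L2_def coefficient_def)
  show "(\<lambda>x. \<kappa> x * (g x \<bullet> h x)) \<in> borel_measurable (lebesgue_on U)"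
    by measurable
  show "integrable (lebesgue_on U) (\<lambda>x. \<beta> * (g x \<bullet> h x))"
    by (intro integrable_mult_right L2_integrable_inner gh)
  show "AE x in lebesgue_on U. norm (\<kappa> x * (g x \<bullet> h x)) \<le> norm (\<beta> * (g x \<bullet> h x))"
    using coefficient_bounds[OF \<kappa>] by eventually_elim (auto simp: abs_mult intro!: mult_right_mono)
qed

lemma semi_inner_on_a_form:
  assumes U: "open U" and \<kappa>: "coefficient U \<kappa> \<gamma> \<beta>"
  shows "semi_inner_on (H1 U) (a_form \<kappa> U)"
proof
  have Us: "U \<in> sets lebesgue" using U by simp
  fix u v w :: "'a \<Rightarrow> real" and c d
  assume H: "u \<in> H1 U" "v \<in> H1 U"
  then show H': "(\<lambda>x. c * u x + d * v x) \<in> H1 U" by (intro H1_lin Us)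
  show "a_form \<kappa> U u v = a_form \<kappa> U v u"
    by (simp add: a_form_def inner_commute)
  have "AE x in lebesgue_on U. 0 \<le> \<kappa> x * (grad U u x \<bullet> grad U u x)"
    using coefficient_bounds[OF \<kappa>] by eventually_elim auto
  then show "0 \<le> a_form \<kappa> U u u"
    unfolding a_form_def by (rule integral_nonneg_AE)
  assume w: "w \<in> H1 U"
  have int: "integrable (lebesgue_on U) (\<lambda>x. \<kappa> x * (grad U p x \<bullet> grad U w x))" if "p \<in> H1 U" for p
    by (intro weighted_inner_integrable[OF \<kappa>] grad_in_L2 that w)
  have "a_form \<kappa> U (\<lambda>x. c * u x + d * v x) w
      = (\<integral>x. c * (\<kappa> x * (grad U u x \<bullet> grad U w x)) + d * (\<kappa> x * (grad U v x \<bullet> grad U w x)) \<partial>lebesgue_on U)"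
    unfolding a_form_def
  proof (rule integral_cong_AE)
    show "AE x in lebesgue_on U. \<kappa> x * (grad U (\<lambda>x. c * u x + d * v x) x \<bullet> grad U w x)
        = c * (\<kappa> x * (grad U u x \<bullet> grad U w x)) + d * (\<kappa> x * (grad U v x \<bullet> grad U w x))"
      using grad_lin[OF U H, of c d] by eventually_elim (simp add: inner_add_left algebra_simps)
  qed (intro borel_measurable_integrable int H' Bochner_Integration.integrable_add integrable_mult_right H)+
  also have "\<dots> = c * a_form \<kappa> U u w + d * a_form \<kappa> U v w"
    using int[OF H(1)] int[OF H(2)] by (simp add: a_form_def)
  finally show "a_form \<kappa> U (\<lambda>x. c * u x + d * v x) w = c * a_form \<kappa> U u w + d * a_form \<kappa> U v w" .
qed

lemma a_form_le_upper_bound: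
  assumes \<kappa>: "coefficient U \<kappa> \<gamma> \<beta>" and v: "v \<in> H1 U"
  shows "a_form \<kappa> U v v \<le> \<beta> * (L2_norm U (grad U v))\<^sup>2"
proof -
  let ?g = "grad U v"
  have "0 \<le> (\<integral>x. ?g x \<bullet> ?g x \<partial>lebesgue_on U)"
    by (intro integral_nonneg_AE AE_I2) simp
  then have "(L2_norm U ?g)\<^sup>2 = (\<integral>x. ?g x \<bullet> ?g x \<partial>lebesgue_on U)"
    by (simp add: L2_norm_def L2_inner_def)
  moreover have "a_form \<kappa> U v v \<le> (\<integral>x. \<beta> * (?g x \<bullet> ?g x) \<partial>lebesgue_on U)"
    unfolding a_form_def
  proof (rule integral_mono_AE)
    show "integrable (lebesgue_on U) (\<lambda>x. \<kappa> x * (?g x \<bullet> ?g x))"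
      by (intro weighted_inner_integrable[OF \<kappa>] grad_in_L2 v)
    show "integrable (lebesgue_on U) (\<lambda>x. \<beta> * (?g x \<bullet> ?g x))"
      by (intro integrable_mult_right L2_integrable_inner grad_in_L2 v)
    show "AE x in lebesgue_on U. \<kappa> x * (?g x \<bullet> ?g x) \<le> \<beta> * (?g x \<bullet> ?g x)"
      using coefficient_bounds[OF \<kappa>] by eventually_elim (auto intro: mult_right_mono)
  qed
  ultimately show ?thesis by simp
qed

text \<open>The bounds hold only almost everywhere, and a nonempty open set is not null, so they hold together at
  some point.\<close>

lemma coefficient_upper_bound_pos:
  assumes "open U" "U \<noteq> {}" "coefficient U \<kappa> \<gamma> \<beta>"
  shows "0 < \<beta>"
proof -
  have "\<not> (AE x in lebesgue_on U. False)"
    using open_not_negligible[OF assms(1,2)] assms(1)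
    by (simp add: AE_restrict_space_iff AE_iff_null_sets negligible_iff_null_sets)
  moreover have "AE x in lebesgue_on U. False" if "\<not> 0 < \<beta>"
    using coefficient_bounds[OF assms(3)] by eventually_elim (use that in auto)
  ultimately show ?thesis by blast
qed

section \<open>The multiscale space and the stability estimate\<close>

lemma V_ms_subset_H1:
  assumes "U \<in> sets lebesgue" "ms_basis U \<kappa> w \<T> l \<phi> m \<psi>"
  shows "V_ms U \<T> l \<psi> \<subseteq> H1 U"
proof
  fix v assume "v \<in> V_ms U \<T> l \<psi>"
  then obtain c where c: "AE x in lebesgue_on U. v x = (\<Sum>K\<in>\<T>. \<Sum>j=1..l K. c K j * \<psi> K j x)"
    by (auto simp: V_ms_def)
  have "\<psi> K j \<in> H1 U" if "K \<in> \<T>" "j \<in> {1..l K}" for K j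
    using assms(2) that by (auto simp: ms_basis_def V0_def H10_def)
  then have "(\<lambda>x. \<Sum>K\<in>\<T>. 1 * (\<Sum>j=1..l K. c K j * \<psi> K j x)) \<in> H1 U"
    by (intro H1_sum assms(1)) auto
  then have "(\<lambda>x. \<Sum>K\<in>\<T>. \<Sum>j=1..l K. c K j * \<psi> K j x) \<in> H1 U"
    by simp
  then show "v \<in> H1 U"
    by (rule H1_cong_AE[OF assms(1)]) (use c in auto)
qed

text \<open>Members of the multiscale space are given by their coefficients up to null sets; the combination has
  the combined coefficients.\<close>

lemma V_ms_lin:
  assumes "u \<in> V_ms U \<T> l \<psi>" "v \<in> V_ms U \<T> l \<psi>"
  shows "(\<lambda>x. p * u x + q * v x) \<in> V_ms U \<T> l \<psi>"
proof -
  obtain c d where "AE x in lebesgue_on U. u x = (\<Sum>K\<in>\<T>. \<Sum>j=1..l K. c K j * \<psi> K j x)"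
    and "AE x in lebesgue_on U. v x = (\<Sum>K\<in>\<T>. \<Sum>j=1..l K. d K j * \<psi> K j x)"
    using assms by (auto simp: V_ms_def)
  then have "AE x in lebesgue_on U. p * u x + q * v x
      = (\<Sum>K\<in>\<T>. \<Sum>j=1..l K. (p * c K j + q * d K j) * \<psi> K j x)"
    by eventually_elim (simp add: sum_distrib_left sum.distrib algebra_simps)
  then show ?thesis
    unfolding V_ms_def by (intro CollectI exI[of _ "\<lambda>K j. p * c K j + q * d K j"])
qed

theorem lemma4p6:
  fixes \<alpha> \<delta> :: real
  assumes dim: "CARD('n::finite) = 2 \<or> CARD('n) = 3"
    and "\<alpha> > 0" and "\<delta> > 0"
  shows "\<exists>C>0. \<forall>(\<Omega> :: (real ^ 'n) set) \<kappa> \<gamma> \<beta> \<T> \<eta> \<mu> \<phi> l m \<psi> C\<^sub>i\<^sub>n\<^sub>v T (N\<^sub>T :: nat) f u.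
    (let w = aux_weight \<Omega> \<kappa> \<T> \<eta>;
         V = V_ms \<Omega> \<T> l \<psi>;
         H = mesh_size \<T>;
         \<Delta>t = T / real N\<^sub>T;
         F = (\<lambda>n::nat. f (real n * \<Delta>t))
     in polygonal_domain \<Omega> \<longrightarrow> coefficient \<Omega> \<kappa> \<gamma> \<beta> \<longrightarrow> coarse_grid \<Omega> \<T> \<longrightarrow>
        ms_functions \<Omega> \<kappa> \<T> \<eta> \<longrightarrow>
        (\<forall>K\<in>\<T>. eigensystem \<Omega> \<kappa> w K (\<mu> K) (\<phi> K) \<and> 1 \<le> l K) \<longrightarrow>
        ms_basis \<Omega> \<kappa> w \<T> l \<phi> m \<psi> \<longrightarrow>
        C\<^sub>i\<^sub>n\<^sub>v > 0 \<longrightarrow> (\<forall>v\<in>V. L2_norm \<Omega> (grad \<Omega> v) \<le> C\<^sub>i\<^sub>n\<^sub>v / H * L2_norm \<Omega> v) \<longrightarrow>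
        T > 0 \<longrightarrow> N\<^sub>T \<ge> 1 \<longrightarrow> (\<forall>n\<le>N\<^sub>T. F n \<in> L2 \<Omega>) \<longrightarrow> (\<forall>n\<le>N\<^sub>T. u n \<in> V) \<longrightarrow>
        (\<forall>n\<in>{1..<N\<^sub>T}. \<forall>v\<in>V.
           L2_inner \<Omega> (\<lambda>x. (u (n + 1) x - u (n - 1) x) / (2 * \<Delta>t)
                        + \<alpha> * ((u (n + 1) x - 2 * u n x + u (n - 1) x) / \<Delta>t\<^sup>2)) v
           + a_form \<kappa> \<Omega> (u n) v = L2_inner \<Omega> (F n) v) \<longrightarrow>
        \<alpha> - 1 / 2 * \<beta> * C\<^sub>i\<^sub>n\<^sub>v\<^sup>2 / H\<^sup>2 * \<Delta>t\<^sup>2 \<ge> \<delta> \<longrightarrow>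
        (\<forall>n\<in>{1..N\<^sub>T}.
           \<alpha> * L2_norm \<Omega> (\<lambda>x. (u n x - u (n - 1) x) / \<Delta>t) + a_norm \<kappa> \<Omega> (u n)
           \<le> C * (\<Delta>t * (\<Sum>k=1..n. L2_norm \<Omega> (F k))
                  + \<alpha> * L2_norm \<Omega> (\<lambda>x. (u 1 x - u 0 x) / \<Delta>t)
                  + a_norm \<kappa> \<Omega> (u 1) + a_norm \<kappa> \<Omega> (u 0))))"
proof -
  define C where "C = (\<alpha> / sqrt \<delta> + sqrt 2) * (1 + 1 / sqrt \<alpha> + 1 / sqrt \<delta>)"
  have "C > 0"
    unfolding C_def using assms(2,3) by (intro mult_pos_pos add_pos_pos) auto
  show ?thesis
  proof (intro exI[of _ C] conjI allI, goal_cases)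
    case 1
    show ?case by fact
  next
    case (2 \<Omega> \<kappa> \<gamma> \<beta> \<T> \<eta> \<mu> \<phi> l m \<psi> C\<^sub>i\<^sub>n\<^sub>v T N f u)
    define w where "w = aux_weight \<Omega> \<kappa> \<T> \<eta>"
    define V where "V = V_ms \<Omega> \<T> l \<psi>"
    define H where "H = mesh_size \<T>"
    define \<tau> where "\<tau> = T / real N"
    define F where "F = (\<lambda>n::nat. f (real n * \<tau>))"
    show ?case
      unfolding Let_def w_def[symmetric] V_def[symmetric] H_def[symmetric] \<tau>_def[symmetric]
    proof (intro impI)
      assume domain: "polygonal_domain \<Omega>" and \<kappa>: "coefficient \<Omega> \<kappa> \<gamma> \<beta>"
        and basis: "ms_basis \<Omega> \<kappa> w \<T> l \<phi> m \<psi>"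
        and inv: "\<forall>v\<in>V. L2_norm \<Omega> (grad \<Omega> v) \<le> C\<^sub>i\<^sub>n\<^sub>v / H * L2_norm \<Omega> v"
        and T: "T > 0" and N: "N \<ge> 1" and F: "\<forall>n\<le>N. f (real n * \<tau>) \<in> L2 \<Omega>"
        and u: "\<forall>n\<le>N. u n \<in> V"
        and scheme: "\<forall>n\<in>{1..<N}. \<forall>v\<in>V.
           L2_inner \<Omega> (\<lambda>x. (u (n + 1) x - u (n - 1) x) / (2 * \<tau>)
                        + \<alpha> * ((u (n + 1) x - 2 * u n x + u (n - 1) x) / \<tau>\<^sup>2)) v
           + a_form \<kappa> \<Omega> (u n) v = L2_inner \<Omega> (f (real n * \<tau>)) v"
        and CFL: "\<alpha> - 1 / 2 * \<beta> * C\<^sub>i\<^sub>n\<^sub>v\<^sup>2 / H\<^sup>2 * \<tau>\<^sup>2 \<ge> \<delta>"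
      have \<Omega>: "open \<Omega>" "\<Omega> \<noteq> {}"
        using domain by (auto simp: polygonal_domain_def)
      then have meas: "\<Omega> \<in> sets lebesgue" by simp
      have VH1: "V \<subseteq> H1 \<Omega>"
        unfolding V_def by (rule V_ms_subset_H1[OF meas basis])
      then have VL2: "V \<subseteq> L2 \<Omega>"
        using H1_subset_L2 by blast
      interpret L2: semi_inner_on "L2 \<Omega>" "L2_inner \<Omega>"
        by (rule semi_inner_on_L2)
      \<comment> \<open>The upper bound of the coefficient and the inverse inequality together bound the Rayleigh quotients.\<close>
      have a_le: "a_form \<kappa> \<Omega> v v \<le> \<beta> * (C\<^sub>i\<^sub>n\<^sub>v / H)\<^sup>2 * L2_inner \<Omega> v v" if v: "v \<in> V" for v
      proof -
        have norm_square: "(L2_norm \<Omega> v)\<^sup>2 = L2_inner \<Omega> v v"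
          using v VL2 by (auto simp: L2_norm_def intro: L2.nonneg)
        have "a_form \<kappa> \<Omega> v v \<le> \<beta> * (L2_norm \<Omega> (grad \<Omega> v))\<^sup>2"
          using a_form_le_upper_bound[OF \<kappa>] VH1 v by blast
        also have "\<dots> \<le> \<beta> * (C\<^sub>i\<^sub>n\<^sub>v / H * L2_norm \<Omega> v)\<^sup>2"
        proof (intro mult_left_mono power_mono)
          show "0 \<le> L2_norm \<Omega> (grad \<Omega> v)"
            by (simp add: L2_norm_def L2_inner_def)
        qed (use inv v coefficient_upper_bound_pos[OF \<Omega> \<kappa>] in auto)
        also have "\<dots> = \<beta> * (C\<^sub>i\<^sub>n\<^sub>v / H)\<^sup>2 * L2_inner \<Omega> v v"
          by (simp only: power_mult_distrib norm_square mult.assoc)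
        finally show ?thesis .
      qed
      have "semi_inner_on V (L2_inner \<Omega>)" "semi_inner_on V (a_form \<kappa> \<Omega>)"
        using semi_inner_on_subset[OF semi_inner_on_L2 VL2]
          semi_inner_on_subset[OF semi_inner_on_a_form[OF \<Omega>(1) \<kappa>] VH1]
        by (simp_all add: V_def V_ms_lin)
      then interpret leapfrog V "L2_inner \<Omega>" "a_form \<kappa> \<Omega>" \<alpha> \<delta> \<tau> "\<beta> * (C\<^sub>i\<^sub>n\<^sub>v / H)\<^sup>2" N u
        "\<lambda>n. L2_inner \<Omega> (F n)" "\<lambda>n. L2_norm \<Omega> (F n)"
      proof (intro leapfrog.intro leapfrog_axioms.intro)
        show "0 < \<tau>" using T N by (simp add: \<tau>_def)
        show "\<delta> \<le> \<alpha> - \<beta> * (C\<^sub>i\<^sub>n\<^sub>v / H)\<^sup>2 * \<tau>\<^sup>2 / 2"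
          using CFL by (simp add: power_divide)
        show "L2_inner \<Omega> (F n) v \<le> L2_norm \<Omega> (F n) * sqrt (L2_inner \<Omega> v v)"
          if "n \<in> {1..<N}" "v \<in> V" for n v
          unfolding L2_norm_def using that F VL2 by (intro L2.Cauchy_Schwarz) (auto simp: F_def)
        show "0 \<le> L2_norm \<Omega> (F n)" if "n \<le> N" for n
          using that F by (auto simp: L2_norm_def F_def intro: L2.nonneg)
      qed (use assms(2,3) a_le u scheme in \<open>auto simp: F_def\<close>)
      have quotient: "(\<lambda>x. (u n x - u (n - 1) x) / \<tau>) = slope n" for n
        by (simp add: slope_def fun_eq_iff)
      have quotient_1: "(\<lambda>x. (u 1 x - u 0 x) / \<tau>) = slope 1"
        by (simp add: slope_def fun_eq_iff)
      show "\<forall>n\<in>{1..N}.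
           \<alpha> * L2_norm \<Omega> (\<lambda>x. (u n x - u (n - 1) x) / \<tau>) + a_norm \<kappa> \<Omega> (u n)
           \<le> C * (\<tau> * (\<Sum>k=1..n. L2_norm \<Omega> (f (real k * \<tau>)))
                  + \<alpha> * L2_norm \<Omega> (\<lambda>x. (u 1 x - u 0 x) / \<tau>)
                  + a_norm \<kappa> \<Omega> (u 1) + a_norm \<kappa> \<Omega> (u 0))"
        using stability unfolding quotient quotient_1 L2_norm_def a_norm_def C_def F_def by blast
    qed
  qed
qed

end
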